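(* Let $d_1,d_2,d_3,r_1,r_2$ be positive integers with $r_1<d_1d_2$ and $r_2\le d_2d_3$. Let $\mathrm{GQSAT}_3$ denote $\mathrm{GQSAT}$ of the following instance: - three qudits of dimensions $d_1,d_2,d_3$; - two hyperedges $\{1,2\}$ and $\{2,3\}$ with ranks $r_1$ and $r_2$. Let $(G_3,c)$ be the following tensor network template: - two inputs $s_1,s_2$ and two outputs $t_1,t_2$; - two vertices $x,y$; - edges with capacities: - $s_1$–$x$, capacity $d_1d_2-r_1$; - $x$–$t_1$, capacity $d_1$; - $x$–$y$, capacity $d_2$; - $s_2$–$y$, capacity $d_3$; - $y$–$t_2$, capacity $r_2$. Then $\mathrm{GQSAT}_3=d_3(d_1d_2-r_1)-\mathrm{QMF}(G_3,c)$.
   Context: A tensor network template $(G,c)$ consists of a finite undirected graph $G$ with edge set $E$ whose vertex set is partitioned as $S\sqcup T\sqcup V$. Every element of $S$ (inputs) and every element of $T$ (outputs) is an open end of degree $1$; the elements of $V$ are called vertices. For $u\in S\sqcup T$, $e(u)$ denotes the edge incident to $u$. A capacity function $c:E\to\mathbb{Z}_{>0}$ is given, and to each edge $e$ one associates $\mathbb{C}^{c_e}$ with a fixed basis. At each vertex $v$ of degree $d_v$ an ordering $e(v,1),\dots,e(v,d_v)$ of the incident edge-ends is fixed. A tensor assignment $\mathcal T=(\mathcal T_v)_{v\in V}$ chooses $\mathcal T_v\in\bigotimes_{i=1}^{d_v}\mathbb{C}^{c_{e(v,i)}}$ for each $v$. Let $V_S=\bigotimes_{u\in S}\mathbb{C}^{c_{e(u)}}$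 and $V_T=\bigotimes_{u\in T}\mathbb{C}^{c_{e(u)}}$. Contracting the network along all edges gives $\beta(G,c;\mathcal T)\in\mathrm{Hom}(V_S,V_T)$, whose matrix entries are $\langle I_T|\beta|I_S\rangle=\sum_W\prod_{v\in V}(\mathcal T_v)_{W|_v}$. Here $W$ ranges over all assignments of basis indices to all edges that agree with $I_S$ on the input edges and with $I_T$ on the output edges, and $W|_v$ is the tuple of indices on $e(v,1),\dots,e(v,d_v)$. The quantum max-flow is $\mathrm{QMF}(G,c)=\max_{\mathcal T}\operatorname{rank}\beta(G,c;\mathcal T)$. $\mathrm{GQSAT}$: an instance consists of $n$ qudits with dimensions $d_1,\dots,d_n$, a set of hyperedges $e\subseteq\{1,\dots,n\}$, and a rank $r_e$ for each hyperedge. For orthogonal projectors $\Pi_e$ of rank $r_e$ on $\bigotimes_{v\in e}\mathbb{C}^{d_v}$, set $H=\sum_e\Pi_e\otimes I_{\{1,\dots,n\}\setminus e}$ acting on $\bigotimes_{v=1}^n\mathbb{C}^{d_v}$. Then $\mathrm{GQSAT}$ of the instance is the minimum of $\dim\ker H$ over all such choices of projectors. This minimum equals the value of $\dim\ker H$ for a generic choice of projectors. *)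

theory Defs
  imports "Jordan_Normal_Form.Matrix_Kernel" "Jordan_Normal_Form.DL_Rank"
          "Jordan_Normal_Form.Schur_Decomposition"
begin

(* Orthogonal projector of rank r on C^N (as an N x N complex matrix). *)
definition orth_projector :: "nat \<Rightarrow> nat \<Rightarrow> complex mat \<Rightarrow> bool" where
  "orth_projector N r P \<longleftrightarrow> P \<in> carrier_mat N N \<and> P * P = P \<and> mat_adjoint P = P
      \<and> vec_space.rank N P = r"

(* Basis of C^{d1} (x) C^{d2} (x) C^{d3}: index (a,b,c) is encoded as a*d2*d3 + b*d3 + c.
   Basis of C^{d1} (x) C^{d2}: (a,b) encoded as a*d2 + b; of C^{d2} (x) C^{d3}: (b,c) as b*d3 + c. *)

(* H = Pi1 (x) I_3 + I_1 (x) Pi2, for hyperedges {1,2} and {2,3}. *)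
definition gqsat3_H :: "nat \<Rightarrow> nat \<Rightarrow> nat \<Rightarrow> complex mat \<Rightarrow> complex mat \<Rightarrow> complex mat" where
  "gqsat3_H d1 d2 d3 P1 P2 = mat (d1*d2*d3) (d1*d2*d3) (\<lambda>(i,j).
     let a = i div (d2*d3); b = (i div d3) mod d2; c = i mod d3;
         a' = j div (d2*d3); b' = (j div d3) mod d2; c' = j mod d3
     in (if c = c' then P1 $$ (a*d2+b, a'*d2+b') else 0)
      + (if a = a' then P2 $$ (b*d3+c, b'*d3+c') else 0))"

(* GQSAT of the instance: qudits of dims d1,d2,d3; hyperedges {1,2} (rank r1), {2,3} (rank r2). *)
definition GQSAT3 :: "nat \<Rightarrow> nat \<Rightarrow> nat \<Rightarrow> nat \<Rightarrow> nat \<Rightarrow> nat" where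
  "GQSAT3 d1 d2 d3 r1 r2 = Inf {kernel_dim (gqsat3_H d1 d2 d3 P1 P2) | P1 P2.
      orth_projector (d1*d2) r1 P1 \<and> orth_projector (d2*d3) r2 P2}"

(* Tensor network G_3: edges s1-x (cap m), x-t1 (cap d1), x-y (cap d2), s2-y (cap d3),
   y-t2 (cap r2). Vertex x has edge-end order (s1-x, x-t1, x-y); vertex y has
   (x-y, s2-y, y-t2). Tensors are given by their coefficient functions Tx, Ty
   (only values at indices within the capacities matter).
   beta : C^m (x) C^d3 -> C^d1 (x) C^r2; column index (i_s1,i_s2) = i_s1*d3 + i_s2,
   row index (i_t1,i_t2) = i_t1*r2 + i_t2. *)
definition G3_beta :: "nat \<Rightarrow> nat \<Rightarrow> nat \<Rightarrow> nat \<Rightarrow> nat \<Rightarrow>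
    (nat \<Rightarrow> nat \<Rightarrow> nat \<Rightarrow> complex) \<Rightarrow> (nat \<Rightarrow> nat \<Rightarrow> nat \<Rightarrow> complex) \<Rightarrow> complex mat" where
  "G3_beta m d1 d2 d3 r2 Tx Ty = mat (d1*r2) (m*d3) (\<lambda>(i,j).
     \<Sum>k<d2. Tx (j div d3) (i div r2) k * Ty k (j mod d3) (i mod r2))"

(* Quantum max-flow of (G_3, c) with c(s1-x) = m. *)
definition QMF_G3 :: "nat \<Rightarrow> nat \<Rightarrow> nat \<Rightarrow> nat \<Rightarrow> nat \<Rightarrow> nat" where
  "QMF_G3 m d1 d2 d3 r2 = Sup {vec_space.rank (d1*r2) (G3_beta m d1 d2 d3 r2 Tx Ty) | Tx Ty. True}"

end

theory Submission
  imports Defs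
begin

text \<open>Write the Hamiltonian as \<open>H = \<Pi>\<^sub>1 \<otimes> 1 + 1 \<otimes> \<Pi>\<^sub>2\<close> and the network map as
  \<open>\<beta> = (1 \<otimes> Q) (B \<otimes> 1)\<close>, with \<open>B : \<complex>\<^sup>m \<rightarrow> \<complex>\<^sup>d\<^sup>1\<^sup>d\<^sup>2\<close> (\<open>m = d\<^sub>1d\<^sub>2 - r\<^sub>1\<close>) and
  \<open>Q : \<complex>\<^sup>d\<^sup>2\<^sup>d\<^sup>3 \<rightarrow> \<complex>\<^sup>r\<^sup>2\<close>. Both summands of \<open>H\<close> are orthogonal projections, so
  \<open>ker H = ker (\<Pi>\<^sub>1 \<otimes> 1) \<inter> ker (1 \<otimes> \<Pi>\<^sub>2)\<close>.

  Given the projectors, let \<open>B\<close> be an isometry onto \<open>ker \<Pi>\<^sub>1\<close> and factor \<open>\<Pi>\<^sub>2 = Z Q\<close> through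
  \<open>\<complex>\<^sup>r\<^sup>2\<close>; then \<open>B \<otimes> 1\<close> embeds \<open>ker \<beta>\<close> into \<open>ker H\<close>, so \<open>dim ker H + rank \<beta> \<ge> m d\<^sub>3\<close>.
  Given the tensors, choose isometries \<open>U\<close> with \<open>m\<close> columns and \<open>V\<close> with \<open>r\<^sub>2\<close> columns whose
  ranges contain those of \<open>B\<close> and \<open>Q\<^sup>*\<close>, and put \<open>\<Pi>\<^sub>1 = 1 - U U\<^sup>*\<close>, \<open>\<Pi>\<^sub>2 = V V\<^sup>*\<close>. Then
  \<open>U\<^sup>* \<otimes> 1\<close> embeds \<open>ker H\<close> into the kernel of \<open>\<beta>' = (1 \<otimes> V\<^sup>*) (U \<otimes> 1)\<close>, whose rank
  bounds that of \<open>\<beta>\<close>; so \<open>dim ker H + rank \<beta> \<le> m d\<^sub>3\<close>. Hence the minimal kernel dimension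
  and the maximal rank add up to \<open>m d\<^sub>3\<close>.\<close>

section \<open>Rank and kernel dimension\<close>

lemma rank_plus_kernel_dim:
  assumes A: "(A :: 'a :: field mat) \<in> carrier_mat nr nc"
  shows "vec_space.rank nr A + kernel_dim A = nc"
proof -
  have hom: "(*\<^sub>v) A \<in> LinearCombinations.module_hom class_ring (module_vec TYPE('a) nc) (module_vec TYPE('a) nr)"
    using A unfolding LinearCombinations.module_hom_def
    by (auto simp: module_vec_simps class_ring_simps mult_add_distrib_mat_vec mult_mat_vec)
  interpret L: linear_map class_ring "module_vec TYPE('a) nc" "module_vec TYPE('a) nr" "(*\<^sub>v) A"
    using vec_vs[of nc] vec_vs[of nr] hom
    by (intro linear_map.intro mod_hom.intro, auto simp: vectorspace_def mod_hom_axioms_def)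
  have im: "L.im = vec_space.col_space nr A"
    unfolding vec_space.col_space_eq[OF A] L.im_def using A by (auto simp: module_vec_simps)
  have ker: "L.ker = mat_kernel A"
    unfolding L.ker_def mat_kernel_def using A by (auto simp: module_vec_simps)
  interpret K: kernel nr nc A by (unfold_locales, rule A)
  from L.rank_nullity[OF vec_space.fin_dim]
  show ?thesis unfolding im ker K.kernel_dim vec_space.rank_def vec_space.dim_is_n
      vec_space.col_space_def by simp
qed

lemma kernel_fin_dim:
  assumes A: "(A :: 'a :: field mat) \<in> carrier_mat nr nc"
  shows "vectorspace.fin_dim class_ring (module_vec TYPE('a) nc\<lparr>carrier := mat_kernel A\<rparr>)"
proof -
  interpret K: kernel nr nc A by (unfold_locales, rule A)
  from kernel_basis_exists[OF A] obtain B where "finite B" "K.basis B" by auto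
  then show ?thesis unfolding K.Ker.fin_dim_def K.Ker.basis_def by auto
qed

lemma mult_mat_vec_module_hom_kernel:
  fixes A B M :: "'a :: field mat"
  assumes A: "A \<in> carrier_mat na ca" and M: "M \<in> carrier_mat cb ca"
    and maps: "\<And>x. x \<in> mat_kernel A \<Longrightarrow> M *\<^sub>v x \<in> mat_kernel B"
  shows "(*\<^sub>v) M \<in> LinearCombinations.module_hom class_ring
    (module_vec TYPE('a) ca\<lparr>carrier := mat_kernel A\<rparr>) (module_vec TYPE('a) cb\<lparr>carrier := mat_kernel B\<rparr>)"
proof (unfold LinearCombinations.module_hom_def, intro CollectI conjI allI impI)
  have kA: "\<And>x. x \<in> mat_kernel A \<Longrightarrow> x \<in> carrier_vec ca" using A mat_kernel_carrier by blast
  show "(*\<^sub>v) M \<in> carrier (module_vec TYPE('a) ca\<lparr>carrier := mat_kernel A\<rparr>)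
      \<rightarrow> carrier (module_vec TYPE('a) cb\<lparr>carrier := mat_kernel B\<rparr>)" using maps by auto
  fix x y assume "x \<in> carrier (module_vec TYPE('a) ca\<lparr>carrier := mat_kernel A\<rparr>) \<and>
    y \<in> carrier (module_vec TYPE('a) ca\<lparr>carrier := mat_kernel A\<rparr>)"
  then have "x \<in> carrier_vec ca" "y \<in> carrier_vec ca" using kA by auto
  then show "M *\<^sub>v (x \<oplus>\<^bsub>module_vec TYPE('a) ca\<lparr>carrier := mat_kernel A\<rparr>\<^esub> y)
    = M *\<^sub>v x \<oplus>\<^bsub>module_vec TYPE('a) cb\<lparr>carrier := mat_kernel B\<rparr>\<^esub> M *\<^sub>v y"
    using M by (simp add: module_vec_simps mult_add_distrib_mat_vec)
next
  have kA: "\<And>x. x \<in> mat_kernel A \<Longrightarrow> x \<in> carrier_vec ca" using A mat_kernel_carrier by blast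
  fix r :: 'a and x assume "r \<in> carrier class_ring \<and> x \<in> carrier (module_vec TYPE('a) ca\<lparr>carrier := mat_kernel A\<rparr>)"
  then have "x \<in> carrier_vec ca" using kA by auto
  then show "M *\<^sub>v (r \<odot>\<^bsub>module_vec TYPE('a) ca\<lparr>carrier := mat_kernel A\<rparr>\<^esub> x)
    = r \<odot>\<^bsub>module_vec TYPE('a) cb\<lparr>carrier := mat_kernel B\<rparr>\<^esub> (M *\<^sub>v x)"
    using M by (simp add: module_vec_simps mult_mat_vec)
qed

lemma kernel_dim_le_via_inj:
  fixes A B M :: "'a :: field mat"
  assumes A: "A \<in> carrier_mat na ca" and B: "B \<in> carrier_mat nb cb" and M: "M \<in> carrier_mat cb ca"
    and maps: "\<And>x. x \<in> mat_kernel A \<Longrightarrow> M *\<^sub>v x \<in> mat_kernel B"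
    and inj: "\<And>x. x \<in> mat_kernel A \<Longrightarrow> M *\<^sub>v x = 0\<^sub>v cb \<Longrightarrow> x = 0\<^sub>v ca"
  shows "kernel_dim A \<le> kernel_dim B"
proof -
  let ?VA = "module_vec TYPE('a) ca\<lparr>carrier := mat_kernel A\<rparr>"
  let ?VB = "module_vec TYPE('a) cb\<lparr>carrier := mat_kernel B\<rparr>"
  let ?T = "(*\<^sub>v) M"
  interpret KA: kernel na ca A by (unfold_locales, rule A)
  interpret KB: kernel nb cb B by (unfold_locales, rule B)
  have hom: "?T \<in> LinearCombinations.module_hom class_ring ?VA ?VB"
    by (rule mult_mat_vec_module_hom_kernel[OF A M maps])
  interpret L1: linear_map class_ring ?VA ?VB ?T
    by (intro linear_map.intro mod_hom.intro, unfold_locales, rule hom)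
  have sub: "VectorSpace.subspace class_ring L1.imT ?VB" by (rule L1.imT_is_subspace)
  let ?W = "KB.Ker.vs L1.imT"
  interpret W: vectorspace class_ring ?W by (rule KB.Ker.subspace_is_vs[OF sub])
  have hom2: "?T \<in> LinearCombinations.module_hom class_ring ?VA ?W"
    using hom unfolding LinearCombinations.module_hom_def L1.im_def by auto
  interpret L2: linear_map class_ring ?VA ?W ?T
    by (intro linear_map.intro mod_hom.intro, unfold_locales, rule hom2)
  have fdA: "KA.Ker.fin_dim" by (rule kernel_fin_dim[OF A])
  have surj: "?T ` carrier ?VA = carrier ?W" unfolding L1.im_def by auto
  have fdW: "W.fin_dim" by (rule L2.rank_nullity_main(2)[OF fdA surj])
  have "inj_on ?T (carrier ?VA)"
  proof (rule inj_onI)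
    fix x y assume x: "x \<in> carrier ?VA" and y: "y \<in> carrier ?VA" and eq: "?T x = ?T y"
    have xc: "x \<in> carrier_vec ca" "y \<in> carrier_vec ca" using x y A mat_kernel_carrier by auto
    have "x - y \<in> mat_kernel A" using x y A by (auto simp: mat_kernel_def mult_minus_distrib_mat_vec)
    moreover have "M *\<^sub>v (x - y) = 0\<^sub>v cb" using eq xc M by (auto simp: mult_minus_distrib_mat_vec)
    ultimately have xy: "x - y = 0\<^sub>v ca" by (rule inj)
    have "x $ i = y $ i" if "i < ca" for i
      using arg_cong[OF xy, of "\<lambda>v. v $ i"] that xc by simp
    then show "x = y" using xc by (intro eq_vecI) auto
  qed
  then have "vectorspace.dim class_ring (KA.Ker.vs L2.kerT) = 0" by (rule L2.inj_imp_dim_ker0)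
  moreover have "W.vs L2.imT = ?W" unfolding L2.im_def L1.im_def using surj by auto
  moreover note L2.rank_nullity[OF fdA]
  ultimately have "W.dim = KA.Ker.dim" by simp
  moreover have "W.dim \<le> KB.Ker.dim" by (rule KB.Ker.subspace_dim[OF sub kernel_fin_dim[OF B] fdW])
  ultimately show ?thesis unfolding KA.kernel_dim KB.kernel_dim by simp
qed

lemma kernel_dim_zero_rows: "kernel_dim (0\<^sub>m 0 k :: 'a :: field mat) = k"
proof -
  have "vec_space.rank 0 (0\<^sub>m 0 k :: 'a mat) = 0" by (rule vec_space.rank_0I)
  then show ?thesis using rank_plus_kernel_dim[of "0\<^sub>m 0 k :: 'a mat" 0 k] by simp
qed

lemma kernel_dim_le_of_inj:
  fixes A M :: "'a :: field mat"
  assumes A: "A \<in> carrier_mat nr nc" and M: "M \<in> carrier_mat k nc"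
    and inj: "\<And>x. x \<in> mat_kernel A \<Longrightarrow> M *\<^sub>v x = 0\<^sub>v k \<Longrightarrow> x = 0\<^sub>v nc"
  shows "kernel_dim A \<le> k"
proof -
  have "kernel_dim A \<le> kernel_dim (0\<^sub>m 0 k :: 'a mat)"
  proof (rule kernel_dim_le_via_inj[OF A zero_carrier_mat M])
    fix x assume "x \<in> mat_kernel A"
    then show "M *\<^sub>v x \<in> mat_kernel (0\<^sub>m 0 k)"
      using M A mat_kernel_carrier by (auto simp: mat_kernel_def)
  qed (rule inj)
  then show ?thesis by (simp add: kernel_dim_zero_rows)
qed

lemma le_kernel_dim_of_inj:
  fixes A M :: "'a :: field mat"
  assumes A: "A \<in> carrier_mat nr nc" and M: "M \<in> carrier_mat nc k"
    and maps: "\<And>x. x \<in> carrier_vec k \<Longrightarrow> M *\<^sub>v x \<in> mat_kernel A"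
    and inj: "\<And>x. x \<in> carrier_vec k \<Longrightarrow> M *\<^sub>v x = 0\<^sub>v nc \<Longrightarrow> x = 0\<^sub>v k"
  shows "k \<le> kernel_dim A"
proof -
  have "kernel_dim (0\<^sub>m 0 k :: 'a mat) \<le> kernel_dim A"
    by (rule kernel_dim_le_via_inj[OF zero_carrier_mat A M], insert maps inj, auto simp: mat_kernel_def)
  then show ?thesis by (simp add: kernel_dim_zero_rows)
qed

lemma kernel_nonzero_vec:
  assumes A: "(A :: 'a :: field mat) \<in> carrier_mat nr nc" and k: "0 < kernel_dim A"
  obtains x where "x \<in> mat_kernel A" "x \<noteq> 0\<^sub>v nc"
proof -
  have "kernel_dim A \<le> 0" if "\<And>x. x \<in> mat_kernel A \<Longrightarrow> x = 0\<^sub>v nc"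
    by (rule kernel_dim_le_of_inj[OF A zero_carrier_mat that])
  with k that show ?thesis by force
qed

lemma rank_le_dim_row:
  assumes A: "(A :: 'a :: field mat) \<in> carrier_mat nr nc"
  shows "vec_space.rank nr A \<le> nr"
proof -
  interpret vec_space "TYPE('a)" nr .
  have "set (cols A) \<subseteq> carrier_vec nr" using A by (auto simp: cols_def)
  then have "VectorSpace.subspace class_ring (span (set (cols A))) V" by (simp add: span_is_subspace)
  from subspace_dim[OF this fin_dim fin_dim_span_cols[OF A]]
  show ?thesis unfolding rank_def dim_is_n by simp
qed

lemma rank_mult_le_left:
  assumes A: "(A :: 'a :: field mat) \<in> carrier_mat n a" and Y: "Y \<in> carrier_mat a b"
  shows "vec_space.rank n (A * Y) \<le> vec_space.rank n A"
proof -
  interpret vec_space "TYPE('a)" n .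
  define W where "W = col_space A"
  define S where "S = col_space (A * Y)"
  have AY: "A * Y \<in> carrier_mat n b" using A Y by auto
  have "S \<subseteq> W"
  proof
    fix z assume "z \<in> S"
    then obtain x where x: "x \<in> carrier_vec b" and z: "z = (A * Y) *\<^sub>v x"
      unfolding S_def col_space_eq[OF AY] using AY by auto
    then have z': "z = A *\<^sub>v (Y *\<^sub>v x)" and Yx: "Y *\<^sub>v x \<in> carrier_vec a" using A Y by auto
    then have "z \<in> carrier_vec n" using A by simp
    moreover have "dim_row A = n" "dim_col A = a" using A by auto
    ultimately show "z \<in> W" using Yx z' unfolding W_def col_space_eq[OF A] by auto
  qed
  have cA: "set (cols A) \<subseteq> carrier_vec n" using A by (auto simp: cols_def)
  have cAY: "set (cols (A * Y)) \<subseteq> carrier_vec n" using A Y by (auto simp: cols_def)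
  have sW: "VectorSpace.subspace class_ring W V"
    unfolding W_def col_space_def using cA by (simp add: span_is_subspace)
  have sS: "VectorSpace.subspace class_ring S V"
    unfolding S_def col_space_def using cAY by (simp add: span_is_subspace)
  have sub: "VectorSpace.subspace class_ring S (vs W)" by (rule nested_subspaces[OF sW sS \<open>S \<subseteq> W\<close>])
  have fW: "vectorspace.fin_dim class_ring (vs W)"
    unfolding W_def col_space_def using fin_dim_span_cols[OF A] .
  have fS: "vectorspace.fin_dim class_ring (vs S)"
    unfolding S_def col_space_def using fin_dim_span_cols[OF AY] .
  interpret W: vectorspace class_ring "vs W" by (rule subspace_is_vs[OF sW])
  have "vectorspace.dim class_ring (W.vs S) \<le> W.dim"
    by (rule W.subspace_dim[OF sub fW], simp add: fS)
  then show ?thesis unfolding rank_def W_def S_def col_space_def by simp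
qed

lemma rank_mult_le_right:
  assumes C: "(C :: 'a :: field mat) \<in> carrier_mat p n" and D: "D \<in> carrier_mat n c"
  shows "vec_space.rank p (C * D) \<le> vec_space.rank n D"
proof -
  have CD: "C * D \<in> carrier_mat p c" using C D by auto
  have "kernel_dim D \<le> kernel_dim (C * D)"
  proof (rule kernel_dim_le_via_inj[OF D CD one_carrier_mat])
    fix x assume "x \<in> mat_kernel D"
    then have x: "x \<in> carrier_vec c" and Dx: "D *\<^sub>v x = 0\<^sub>v n" using mat_kernelD[OF D] by auto
    have "(C * D) *\<^sub>v x = C *\<^sub>v (D *\<^sub>v x)" using C D x by auto
    also have "\<dots> = 0\<^sub>v p" using Dx C by auto
    finally show "1\<^sub>m c *\<^sub>v x \<in> mat_kernel (C * D)" using x CD by (auto intro: mat_kernelI)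
  next
    fix x assume "x \<in> mat_kernel D" "1\<^sub>m c *\<^sub>v x = 0\<^sub>v c"
    then show "x = 0\<^sub>v c" using mat_kernelD[OF D] by auto
  qed
  then show ?thesis using rank_plus_kernel_dim[OF D] rank_plus_kernel_dim[OF CD] by linarith
qed

section \<open>Adjoints and tensor products with identity matrices\<close>

lemma sum_lessThan_mult:
  fixes f :: "nat \<Rightarrow> 'a :: comm_monoid_add"
  shows "(\<Sum>l<b * d. f l) = (\<Sum>q<b. \<Sum>r<d. f (q * d + r))"
proof -
  have "(\<Sum>l\<in>{q * d..<q * d + d}. f l) = (\<Sum>r<d. f (q * d + r))" for q
    using sum.shift_bounds_nat_ivl[of f 0 "q * d" d] by (simp add: add.commute lessThan_atLeast0)
  then show ?thesis by (simp add: sum.nat_group[symmetric])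
qed

lemma index_mult_mat_sum:
  assumes "A \<in> carrier_mat a b" "B \<in> carrier_mat b c" "i < a" "j < c"
  shows "(A * B) $$ (i, j) = (\<Sum>l<b. A $$ (i, l) * B $$ (l, j))"
  using assms by (auto simp: scalar_prod_def lessThan_atLeast0 intro!: sum.cong)

lemma index_mult_mat_vec_sum:
  "A \<in> carrier_mat n m \<Longrightarrow> x \<in> carrier_vec m \<Longrightarrow> i < n \<Longrightarrow>
    (A *\<^sub>v x) $ i = (\<Sum>j<m. A $$ (i, j) * x $ j)"
  by (auto simp: scalar_prod_def lessThan_atLeast0 intro!: sum.cong)

lemma mult_mat_vec_zero [simp]:
  "A \<in> carrier_mat n k \<Longrightarrow> A *\<^sub>v 0\<^sub>v k = (0\<^sub>v n :: 'a :: semiring_0 vec)"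
  by (intro eq_vecI) (auto simp: scalar_prod_def)

lemma mult_add_div_mod:
  fixes q r d :: nat
  assumes "r < d"
  shows "(q * d + r) div d = q" "(q * d + r) mod d = r"
  using assms by auto

lemma mult_add_less_mult:
  fixes q r b d :: nat
  assumes "q < b" "r < d"
  shows "q * d + r < b * d"
proof -
  have "q * d + r < Suc q * d" using assms by simp
  also have "\<dots> \<le> b * d" using assms by (intro mult_le_mono1) simp
  finally show ?thesis .
qed

lemma mat_adjoint_eq:
  "mat_adjoint (A :: complex mat) = mat (dim_col A) (dim_row A) (\<lambda>(i, j). cnj (A $$ (j, i)))"
  unfolding mat_adjoint_def by (rule eq_matI, auto simp: mat_of_rows_def)

lemma mat_adjoint_carrier [simp]:
  "A \<in> carrier_mat n m \<Longrightarrow> mat_adjoint (A :: complex mat) \<in> carrier_mat m n"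
  unfolding mat_adjoint_eq by auto

lemma dim_mat_adjoint [simp]:
  "dim_row (mat_adjoint (A :: complex mat)) = dim_col A"
  "dim_col (mat_adjoint (A :: complex mat)) = dim_row A"
  unfolding mat_adjoint_eq by auto

lemma index_mat_adjoint [simp]:
  "i < dim_col A \<Longrightarrow> j < dim_row A \<Longrightarrow> mat_adjoint (A :: complex mat) $$ (i, j) = cnj (A $$ (j, i))"
  unfolding mat_adjoint_eq by auto

lemma mat_adjoint_mult:
  assumes A: "(A :: complex mat) \<in> carrier_mat a b" and B: "B \<in> carrier_mat b c"
  shows "mat_adjoint (A * B) = mat_adjoint B * mat_adjoint A"
proof (rule eq_matI)
  fix i j assume "i < dim_row (mat_adjoint B * mat_adjoint A)" "j < dim_col (mat_adjoint B * mat_adjoint A)"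
  then have i: "i < c" and j: "j < a" using A B by auto
  have "mat_adjoint (A * B) $$ (i, j) = cnj ((A * B) $$ (j, i))" using i j A B by simp
  also have "\<dots> = (\<Sum>l<b. cnj (A $$ (j, l)) * cnj (B $$ (l, i)))"
    using index_mult_mat_sum[OF A B j i] by (simp add: cnj_sum)
  also have "\<dots> = (mat_adjoint B * mat_adjoint A) $$ (i, j)"
    by (subst index_mult_mat_sum[of _ c b _ a], insert A B i j, auto intro: sum.cong)
  finally show "mat_adjoint (A * B) $$ (i, j) = (mat_adjoint B * mat_adjoint A) $$ (i, j)" .
qed (insert A B, auto)

lemma mat_adjoint_mat_adjoint [simp]: "mat_adjoint (mat_adjoint (A :: complex mat)) = A"
  by (rule eq_matI, auto)

lemma mat_adjoint_one [simp]: "mat_adjoint (1\<^sub>m n :: complex mat) = 1\<^sub>m n"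
  by (rule eq_matI, auto)

lemma mat_adjoint_minus:
  assumes "(A :: complex mat) \<in> carrier_mat a b" "B \<in> carrier_mat a b"
  shows "mat_adjoint (A - B) = mat_adjoint A - mat_adjoint B"
  by (rule eq_matI, insert assms, auto)

lemma cscalar_prod_mat_adjoint:
  assumes A: "(A :: complex mat) \<in> carrier_mat n m" and x: "x \<in> carrier_vec m" and y: "y \<in> carrier_vec n"
  shows "(A *\<^sub>v x) \<bullet>c y = x \<bullet>c (mat_adjoint A *\<^sub>v y)"
proof -
  have "(A *\<^sub>v x) \<bullet>c y = (\<Sum>i<n. (\<Sum>j<m. A $$ (i, j) * x $ j) * cnj (y $ i))"
    using A x y by (auto simp: scalar_prod_def lessThan_atLeast0 index_mult_mat_vec_sum[OF A x]
        intro!: sum.cong)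
  also have "\<dots> = (\<Sum>j<m. x $ j * (\<Sum>i<n. A $$ (i, j) * cnj (y $ i)))"
    by (simp add: sum_distrib_left sum_distrib_right mult_ac sum.swap[of _ "{..<n}"])
  also have "\<dots> = x \<bullet>c (mat_adjoint A *\<^sub>v y)"
    using A x y by (auto simp: scalar_prod_def lessThan_atLeast0 cnj_sum
        index_mult_mat_vec_sum[OF mat_adjoint_carrier[OF A] y] intro!: sum.cong)
  finally show ?thesis .
qed

text \<open>\<open>kron_id_right d X = X \<otimes> 1\<^sub>d\<close> and \<open>kron_id_left d Y = 1\<^sub>d \<otimes> Y\<close>, where as in
  \<open>gqsat3_H\<close> the basis vector \<open>e\<^sub>i \<otimes> e\<^sub>j\<close> of \<open>\<complex>\<^sup>a \<otimes> \<complex>\<^sup>b\<close> has index \<open>i * b + j\<close>.\<close>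

definition kron_id_right :: "nat \<Rightarrow> 'a :: comm_ring_1 mat \<Rightarrow> 'a mat" where
  "kron_id_right d X = mat (dim_row X * d) (dim_col X * d)
     (\<lambda>(i, j). if i mod d = j mod d then X $$ (i div d, j div d) else 0)"

definition kron_id_left :: "nat \<Rightarrow> 'a :: comm_ring_1 mat \<Rightarrow> 'a mat" where
  "kron_id_left d Y = mat (d * dim_row Y) (d * dim_col Y)
     (\<lambda>(i, j). if i div dim_row Y = j div dim_col Y then Y $$ (i mod dim_row Y, j mod dim_col Y) else 0)"

lemma dim_kron_id [simp]:
  "dim_row (kron_id_right d X) = dim_row X * d" "dim_col (kron_id_right d X) = dim_col X * d"
  "dim_row (kron_id_left d Y) = d * dim_row Y" "dim_col (kron_id_left d Y) = d * dim_col Y"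
  unfolding kron_id_right_def kron_id_left_def by auto

lemma kron_id_right_carrier [simp]:
  "X \<in> carrier_mat a b \<Longrightarrow> kron_id_right d X \<in> carrier_mat (a * d) (b * d)"
  unfolding kron_id_right_def by auto

lemma kron_id_left_carrier [simp]:
  "Y \<in> carrier_mat a b \<Longrightarrow> kron_id_left d Y \<in> carrier_mat (d * a) (d * b)"
  unfolding kron_id_left_def by auto

lemma index_kron_id_right:
  "X \<in> carrier_mat a b \<Longrightarrow> i < a * d \<Longrightarrow> j < b * d \<Longrightarrow>
    kron_id_right d X $$ (i, j) = (if i mod d = j mod d then X $$ (i div d, j div d) else 0)"
  unfolding kron_id_right_def by auto

lemma index_kron_id_left:
  "Y \<in> carrier_mat a b \<Longrightarrow> i < d * a \<Longrightarrow> j < d * b \<Longrightarrow>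
    kron_id_left d Y $$ (i, j) = (if i div a = j div b then Y $$ (i mod a, j mod b) else 0)"
  unfolding kron_id_left_def by auto

lemma kron_id_right_mult:
  assumes X: "X \<in> carrier_mat a b" and Y: "Y \<in> carrier_mat b c" and d: "0 < d"
  shows "kron_id_right d (X * Y) = kron_id_right d X * kron_id_right d Y"
proof (rule eq_matI)
  fix i j assume "i < dim_row (kron_id_right d X * kron_id_right d Y)"
    "j < dim_col (kron_id_right d X * kron_id_right d Y)"
  then have i: "i < a * d" and j: "j < c * d" using X Y by auto
  have id: "i div d < a" and jd: "j div d < c" using i j by (simp_all add: less_mult_imp_div_less)
  have im: "i mod d < d" using d by auto
  have "(kron_id_right d X * kron_id_right d Y) $$ (i, j)
      = (\<Sum>q<b. \<Sum>r<d. kron_id_right d X $$ (i, q * d + r) * kron_id_right d Y $$ (q * d + r, j))"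
    by (simp add: index_mult_mat_sum[OF kron_id_right_carrier[OF X] kron_id_right_carrier[OF Y] i j]
        sum_lessThan_mult)
  also have "\<dots> = (\<Sum>q<b. \<Sum>r<d. if r = i mod d then
      X $$ (i div d, q) * (if i mod d = j mod d then Y $$ (q, j div d) else 0) else 0)"
  proof (intro sum.cong refl)
    fix q r assume "q \<in> {..<b}" and r: "r \<in> {..<d}"
    then have "q * d + r < b * d" by (simp add: mult_add_less_mult)
    then show "kron_id_right d X $$ (i, q * d + r) * kron_id_right d Y $$ (q * d + r, j)
      = (if r = i mod d then X $$ (i div d, q) * (if i mod d = j mod d then Y $$ (q, j div d) else 0) else 0)"
      using index_kron_id_right[OF X i] index_kron_id_right[OF Y _ j] r mult_add_div_mod[of r d q] by auto
  qed
  also have "\<dots> = (\<Sum>q<b. X $$ (i div d, q) * (if i mod d = j mod d then Y $$ (q, j div d) else 0))"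
    using im by (simp add: sum.delta)
  also have "\<dots> = kron_id_right d (X * Y) $$ (i, j)"
    using index_kron_id_right[OF mult_carrier_mat[OF X Y] i j] index_mult_mat_sum[OF X Y id jd] by auto
  finally show "kron_id_right d (X * Y) $$ (i, j) = (kron_id_right d X * kron_id_right d Y) $$ (i, j)" ..
qed (insert X Y, auto simp: kron_id_right_def)

lemma kron_id_left_mult:
  assumes X: "X \<in> carrier_mat a b" and Y: "Y \<in> carrier_mat b c"
  shows "kron_id_left d (X * Y) = kron_id_left d X * kron_id_left d Y"
proof (rule eq_matI)
  fix i j assume "i < dim_row (kron_id_left d X * kron_id_left d Y)"
    "j < dim_col (kron_id_left d X * kron_id_left d Y)"
  then have i: "i < d * a" and j: "j < d * c" using X Y by (auto simp: kron_id_left_def)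
  have "0 < a" "0 < c" using i j by (auto intro: ccontr)
  then have id: "i div a < d" and im: "i mod a < a" "j mod c < c"
    using i by (auto simp: less_mult_imp_div_less mult.commute)
  have "(kron_id_left d X * kron_id_left d Y) $$ (i, j)
      = (\<Sum>p<d. \<Sum>s<b. kron_id_left d X $$ (i, p * b + s) * kron_id_left d Y $$ (p * b + s, j))"
    by (simp add: index_mult_mat_sum[OF kron_id_left_carrier[OF X] kron_id_left_carrier[OF Y] i j]
        sum_lessThan_mult[of _ d b, simplified mult.commute[of d b]] mult.commute[of d b])
  also have "\<dots> = (\<Sum>p<d. \<Sum>s<b. if p = i div a then
      X $$ (i mod a, s) * (if i div a = j div c then Y $$ (s, j mod c) else 0) else 0)"
  proof (intro sum.cong refl)
    fix p s assume "p \<in> {..<d}" and s: "s \<in> {..<b}"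
    then have "p * b + s < d * b" by (simp add: mult_add_less_mult)
    then show "kron_id_left d X $$ (i, p * b + s) * kron_id_left d Y $$ (p * b + s, j)
      = (if p = i div a then X $$ (i mod a, s) * (if i div a = j div c then Y $$ (s, j mod c) else 0) else 0)"
      using index_kron_id_left[OF X i] index_kron_id_left[OF Y _ j] s mult_add_div_mod[of s b p] by auto
  qed
  also have "\<dots> = (\<Sum>s<b. X $$ (i mod a, s) * (if i div a = j div c then Y $$ (s, j mod c) else 0))"
    by (subst sum.swap, insert id, simp add: sum.delta)
  also have "\<dots> = kron_id_left d (X * Y) $$ (i, j)"
    using index_kron_id_left[OF mult_carrier_mat[OF X Y] i j] index_mult_mat_sum[OF X Y im] by auto
  finally show "kron_id_left d (X * Y) $$ (i, j) = (kron_id_left d X * kron_id_left d Y) $$ (i, j)" ..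
qed (insert X Y, auto simp: kron_id_left_def)

lemma kron_id_right_one: "0 < d \<Longrightarrow> kron_id_right d (1\<^sub>m a) = 1\<^sub>m (a * d)"
proof (rule eq_matI)
  fix i j assume "0 < d" "i < dim_row (1\<^sub>m (a * d))" "j < dim_col (1\<^sub>m (a * d))"
  then have i: "i < a * d" and j: "j < a * d" by auto
  have "i div d < a" "j div d < a" using i j by (auto simp: less_mult_imp_div_less)
  moreover have "(i = j) = (i mod d = j mod d \<and> i div d = j div d)"
    by (metis div_mult_mod_eq)
  ultimately show "kron_id_right d (1\<^sub>m a) $$ (i, j) = 1\<^sub>m (a * d) $$ (i, j)"
    using index_kron_id_right[OF one_carrier_mat i j] i j by auto
qed (auto simp: kron_id_right_def)

lemma kron_id_right_zero: "kron_id_right d (0\<^sub>m a b) = 0\<^sub>m (a * d) (b * d)"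
  by (rule eq_matI, auto simp: kron_id_right_def less_mult_imp_div_less)

lemma kron_id_right_minus:
  "A \<in> carrier_mat a b \<Longrightarrow> B \<in> carrier_mat a b \<Longrightarrow>
    kron_id_right d (A - B) = kron_id_right d A - kron_id_right d B"
  by (rule eq_matI, auto simp: kron_id_right_def less_mult_imp_div_less)

lemma kron_id_right_adjoint:
  "0 < d \<Longrightarrow> (X :: complex mat) \<in> carrier_mat a b \<Longrightarrow>
    kron_id_right d (mat_adjoint X) = mat_adjoint (kron_id_right d X)"
  by (rule eq_matI, auto simp: kron_id_right_def less_mult_imp_div_less)

lemma kron_id_left_adjoint:
  assumes X: "(X :: complex mat) \<in> carrier_mat a b"
  shows "kron_id_left d (mat_adjoint X) = mat_adjoint (kron_id_left d X)"
proof (rule eq_matI)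
  fix i j assume "i < dim_row (mat_adjoint (kron_id_left d X))" "j < dim_col (mat_adjoint (kron_id_left d X))"
  then have i: "i < d * b" and j: "j < d * a" using X by (auto simp: kron_id_left_def)
  then have "0 < a" "0 < b" by (auto intro: ccontr)
  then show "kron_id_left d (mat_adjoint X) $$ (i, j) = mat_adjoint (kron_id_left d X) $$ (i, j)"
    using index_kron_id_left[OF mat_adjoint_carrier[OF X] i j] index_kron_id_left[OF X j i] X i j
    by (auto simp: kron_id_left_def)
qed (insert X, auto simp: kron_id_left_def)

section \<open>Orthogonal projections and isometries\<close>

definition hermitian_idempotent :: "nat \<Rightarrow> complex mat \<Rightarrow> bool" where
  "hermitian_idempotent n P \<longleftrightarrow> P \<in> carrier_mat n n \<and> mat_adjoint P = P \<and> P * P = P"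

lemma orth_projector_iff:
  "orth_projector n r P \<longleftrightarrow> hermitian_idempotent n P \<and> vec_space.rank n P = r"
  unfolding orth_projector_def hermitian_idempotent_def by auto

lemma hermitian_idempotent_cscalar_prod:
  assumes P: "hermitian_idempotent n P" and v: "v \<in> carrier_vec n"
  shows "(P *\<^sub>v v) \<bullet>c v = (P *\<^sub>v v) \<bullet>c (P *\<^sub>v v)"
proof -
  have Pc: "P \<in> carrier_mat n n" and h: "mat_adjoint P = P" and i: "P * P = P"
    using P unfolding hermitian_idempotent_def by auto
  have "P *\<^sub>v v = P *\<^sub>v (P *\<^sub>v v)" using Pc v by (metis assoc_mult_mat_vec i)
  then have "(P *\<^sub>v v) \<bullet>c v = (P *\<^sub>v (P *\<^sub>v v)) \<bullet>c v" by simp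
  also have "\<dots> = (P *\<^sub>v v) \<bullet>c (P *\<^sub>v v)"
    using cscalar_prod_mat_adjoint[OF Pc _ v, of "P *\<^sub>v v"] Pc v h by simp
  finally show ?thesis .
qed

text \<open>Since \<open>((P + Q) v) \<bullet>c v = \<parallel>P v\<parallel>\<^sup>2 + \<parallel>Q v\<parallel>\<^sup>2\<close>, the kernel of a sum of orthogonal
  projections is the intersection of their kernels.\<close>

lemma hermitian_idempotent_add_kernel:
  assumes P: "hermitian_idempotent n P" and Q: "hermitian_idempotent n Q" and v: "v \<in> carrier_vec n"
    and z: "(P + Q) *\<^sub>v v = 0\<^sub>v n"
  shows "P *\<^sub>v v = 0\<^sub>v n"
proof -
  have Pc: "P \<in> carrier_mat n n" and Qc: "Q \<in> carrier_mat n n"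
    using P Q unfolding hermitian_idempotent_def by auto
  have Pv: "P *\<^sub>v v \<in> carrier_vec n" and Qv: "Q *\<^sub>v v \<in> carrier_vec n" using Pc Qc v by auto
  have "0 = ((P + Q) *\<^sub>v v) \<bullet>c v" unfolding z using v by simp
  also have "\<dots> = (P *\<^sub>v v) \<bullet>c v + (Q *\<^sub>v v) \<bullet>c v"
    using Pc Qc v by (simp add: add_mult_distrib_mat_vec add_scalar_prod_distrib[of _ n])
  also have "\<dots> = (P *\<^sub>v v) \<bullet>c (P *\<^sub>v v) + (Q *\<^sub>v v) \<bullet>c (Q *\<^sub>v v)"
    using hermitian_idempotent_cscalar_prod[OF P v] hermitian_idempotent_cscalar_prod[OF Q v] by simp
  finally have "(P *\<^sub>v v) \<bullet>c (P *\<^sub>v v) = 0"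
    using conjugate_square_ge_0_vec[of "P *\<^sub>v v"] conjugate_square_ge_0_vec[of "Q *\<^sub>v v"]
    by (simp add: add_nonneg_eq_0_iff)
  then show ?thesis using Pv by simp
qed

lemma hermitian_idempotent_compl:
  assumes P: "hermitian_idempotent n P"
  shows "hermitian_idempotent n (1\<^sub>m n - P)"
proof -
  have Pc: "P \<in> carrier_mat n n" and h: "mat_adjoint P = P" and i: "P * P = P"
    using P unfolding hermitian_idempotent_def by auto
  have c: "1\<^sub>m n - P \<in> carrier_mat n n" using Pc by auto
  have "(1\<^sub>m n - P) * (1\<^sub>m n - P) = 1\<^sub>m n * (1\<^sub>m n - P) - P * (1\<^sub>m n - P)"
    by (rule minus_mult_distrib_mat[OF one_carrier_mat Pc c])
  also have "P * (1\<^sub>m n - P) = P * 1\<^sub>m n - P * P" by (rule mult_minus_distrib_mat[OF Pc one_carrier_mat Pc])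
  also have "1\<^sub>m n * (1\<^sub>m n - P) - (P * 1\<^sub>m n - P * P) = (1\<^sub>m n - P) - (P - P * P)" using Pc c by simp
  also have "\<dots> = 1\<^sub>m n - P" unfolding i using Pc by (intro eq_matI, auto)
  finally show ?thesis unfolding hermitian_idempotent_def
    using Pc c mat_adjoint_minus[OF one_carrier_mat Pc] h by simp
qed

lemma kron_id_right_hermitian_idempotent:
  assumes P: "hermitian_idempotent n P" and d: "0 < d"
  shows "hermitian_idempotent (n * d) (kron_id_right d P)"
proof -
  have Pc: "P \<in> carrier_mat n n" and h: "mat_adjoint P = P" and i: "P * P = P"
    using P unfolding hermitian_idempotent_def by auto
  show ?thesis unfolding hermitian_idempotent_def
    using kron_id_right_adjoint[OF d Pc] kron_id_right_mult[OF Pc Pc d] h i Pc by simp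
qed

lemma kron_id_left_hermitian_idempotent:
  assumes P: "hermitian_idempotent n P"
  shows "hermitian_idempotent (d * n) (kron_id_left d P)"
proof -
  have Pc: "P \<in> carrier_mat n n" and h: "mat_adjoint P = P" and i: "P * P = P"
    using P unfolding hermitian_idempotent_def by auto
  show ?thesis unfolding hermitian_idempotent_def
    using kron_id_left_adjoint[OF Pc] kron_id_left_mult[OF Pc Pc] h i Pc by simp
qed

definition isometry :: "nat \<Rightarrow> nat \<Rightarrow> complex mat \<Rightarrow> bool" where
  "isometry n k U \<longleftrightarrow> U \<in> carrier_mat n k \<and> mat_adjoint U * U = 1\<^sub>m k"

lemma isometry_iff_orthonormal:
  "isometry n k U \<longleftrightarrow> U \<in> carrier_mat n k \<and>
    (\<forall>i<k. \<forall>j<k. (\<Sum>l<n. cnj (U $$ (l, i)) * U $$ (l, j)) = (if i = j then 1 else 0))"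
proof (cases "U \<in> carrier_mat n k")
  case Uc: True
  have entry: "(mat_adjoint U * U) $$ (i, j) = (\<Sum>l<n. cnj (U $$ (l, i)) * U $$ (l, j))"
    if "i < k" "j < k" for i j
    using index_mult_mat_sum[OF mat_adjoint_carrier[OF Uc] Uc that] Uc that by (auto intro!: sum.cong)
  show ?thesis
  proof
    assume "isometry n k U"
    then show "U \<in> carrier_mat n k \<and>
      (\<forall>i<k. \<forall>j<k. (\<Sum>l<n. cnj (U $$ (l, i)) * U $$ (l, j)) = (if i = j then 1 else 0))"
      using entry unfolding isometry_def by auto
  next
    assume "U \<in> carrier_mat n k \<and>
      (\<forall>i<k. \<forall>j<k. (\<Sum>l<n. cnj (U $$ (l, i)) * U $$ (l, j)) = (if i = j then 1 else 0))"
    then have "mat_adjoint U * U = 1\<^sub>m k" using Uc entry by (intro eq_matI) auto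
    then show "isometry n k U" unfolding isometry_def using Uc by auto
  qed
qed (simp add: isometry_def)

lemma isometry_mult_vec_eq_0:
  assumes U: "isometry n k U" and x: "x \<in> carrier_vec k" and z: "U *\<^sub>v x = 0\<^sub>v n"
  shows "x = 0\<^sub>v k"
proof -
  have Uc: "U \<in> carrier_mat n k" and I: "mat_adjoint U * U = 1\<^sub>m k" using U unfolding isometry_def by auto
  have "x = (mat_adjoint U * U) *\<^sub>v x" using I x by auto
  also have "\<dots> = mat_adjoint U *\<^sub>v (U *\<^sub>v x)" by (rule assoc_mult_mat_vec[OF mat_adjoint_carrier[OF Uc] Uc x])
  also have "\<dots> = 0\<^sub>v k" unfolding z using Uc by auto
  finally show ?thesis .
qed

lemma isometry_rank:
  assumes U: "isometry n k U"
  shows "vec_space.rank n U = k"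
proof -
  have Uc: "U \<in> carrier_mat n k" using U unfolding isometry_def by auto
  have "kernel_dim U \<le> 0"
  proof (rule kernel_dim_le_of_inj[OF Uc zero_carrier_mat])
    fix x assume "x \<in> mat_kernel U"
    then show "x = 0\<^sub>v k" using mat_kernelD[OF Uc] isometry_mult_vec_eq_0[OF U] by auto
  qed
  then show ?thesis using rank_plus_kernel_dim[OF Uc] by simp
qed

lemma isometry_mult:
  assumes U: "isometry n k U" and W: "isometry k b W"
  shows "isometry n b (U * W)"
proof -
  have Uc: "U \<in> carrier_mat n k" and I: "mat_adjoint U * U = 1\<^sub>m k" using U unfolding isometry_def by auto
  have Wc: "W \<in> carrier_mat k b" and I2: "mat_adjoint W * W = 1\<^sub>m b" using W unfolding isometry_def by auto
  have "mat_adjoint (U * W) * (U * W) = mat_adjoint W * (mat_adjoint U * U) * W"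
    unfolding mat_adjoint_mult[OF Uc Wc]
    using assoc_mult_mat[OF mat_adjoint_carrier[OF Wc] mat_adjoint_carrier[OF Uc] mult_carrier_mat[OF Uc Wc]]
      assoc_mult_mat[OF mat_adjoint_carrier[OF Uc] Uc Wc]
      assoc_mult_mat[OF mat_adjoint_carrier[OF Wc] mult_carrier_mat[OF mat_adjoint_carrier[OF Uc] Uc] Wc]
    by simp
  also have "\<dots> = 1\<^sub>m b" unfolding I using Wc I2 by simp
  finally show ?thesis unfolding isometry_def using Uc Wc by auto
qed

lemma kron_id_right_isometry:
  assumes B: "isometry n m B" and d: "0 < d"
  shows "isometry (n * d) (m * d) (kron_id_right d B)"
proof -
  have Bc: "B \<in> carrier_mat n m" and I: "mat_adjoint B * B = 1\<^sub>m m" using B unfolding isometry_def by auto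
  have "mat_adjoint (kron_id_right d B) * kron_id_right d B = kron_id_right d (mat_adjoint B * B)"
    using kron_id_right_mult[OF mat_adjoint_carrier[OF Bc] Bc d] kron_id_right_adjoint[OF d Bc] by simp
  also have "\<dots> = 1\<^sub>m (m * d)" unfolding I by (rule kron_id_right_one[OF d])
  finally show ?thesis unfolding isometry_def using Bc by simp
qed

lemma hermitian_idempotent_isometry_proj:
  assumes U: "isometry n k U"
  shows "hermitian_idempotent n (U * mat_adjoint U)"
proof -
  have Uc: "U \<in> carrier_mat n k" and I: "mat_adjoint U * U = 1\<^sub>m k" using U unfolding isometry_def by auto
  have Ua: "mat_adjoint U \<in> carrier_mat k n" using Uc by simp
  have "U * mat_adjoint U * (U * mat_adjoint U) = U * (mat_adjoint U * (U * mat_adjoint U))"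
    by (rule assoc_mult_mat[OF Uc Ua mult_carrier_mat[OF Uc Ua]])
  also have "mat_adjoint U * (U * mat_adjoint U) = (mat_adjoint U * U) * mat_adjoint U"
    by (rule assoc_mult_mat[OF Ua Uc Ua, symmetric])
  also have "U * ((mat_adjoint U * U) * mat_adjoint U) = U * mat_adjoint U"
    using I left_mult_one_mat[OF Ua] by simp
  finally show ?thesis
    unfolding hermitian_idempotent_def using Uc Ua mat_adjoint_mult[OF Uc Ua] by simp
qed

lemma orth_projector_isometry_proj:
  assumes U: "isometry n k U"
  shows "orth_projector n k (U * mat_adjoint U)"
proof -
  have Uc: "U \<in> carrier_mat n k" and I: "mat_adjoint U * U = 1\<^sub>m k" using U unfolding isometry_def by auto
  have Ua: "mat_adjoint U \<in> carrier_mat k n" using Uc by simp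
  have "vec_space.rank n (U * mat_adjoint U) \<le> k"
    using rank_mult_le_left[OF Uc Ua] isometry_rank[OF U] by simp
  moreover have "U * mat_adjoint U * U = U" using Uc Ua I by (simp add: assoc_mult_mat[OF Uc Ua Uc])
  then have "k \<le> vec_space.rank n (U * mat_adjoint U)"
    using rank_mult_le_left[OF mult_carrier_mat[OF Uc Ua] Uc] isometry_rank[OF U] by simp
  ultimately show ?thesis
    unfolding orth_projector_iff using hermitian_idempotent_isometry_proj[OF U] by simp
qed

lemma orth_projector_compl_isometry_proj:
  assumes U: "isometry n k U"
  shows "orth_projector n (n - k) (1\<^sub>m n - U * mat_adjoint U)"
proof -
  have Uc: "U \<in> carrier_mat n k" and I: "mat_adjoint U * U = 1\<^sub>m k" using U unfolding isometry_def by auto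
  have Ua: "mat_adjoint U \<in> carrier_mat k n" using Uc by simp
  let ?P = "1\<^sub>m n - U * mat_adjoint U"
  have Pc: "?P \<in> carrier_mat n n" using Uc by auto
  have "k \<le> kernel_dim ?P"
  proof (rule le_kernel_dim_of_inj[OF Pc Uc])
    fix x :: "complex vec" assume x: "x \<in> carrier_vec k"
    have "?P *\<^sub>v (U *\<^sub>v x) = (?P * U) *\<^sub>v x" using Pc Uc x by auto
    also have "?P * U = U - U * (mat_adjoint U * U)"
      using Uc Ua by (simp add: minus_mult_distrib_mat[of _ n n] assoc_mult_mat[OF Uc Ua Uc])
    also have "\<dots> = 0\<^sub>m n k" unfolding I using Uc by (intro eq_matI) auto
    also have "0\<^sub>m n k *\<^sub>v x = 0\<^sub>v n" using x by auto
    finally show "U *\<^sub>v x \<in> mat_kernel ?P" using Pc Uc x by (auto intro: mat_kernelI)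
  qed (rule isometry_mult_vec_eq_0[OF U])
  moreover have "kernel_dim ?P \<le> k"
  proof (rule kernel_dim_le_of_inj[OF Pc Ua])
    fix x assume "x \<in> mat_kernel ?P" and z: "mat_adjoint U *\<^sub>v x = 0\<^sub>v k"
    then have x: "x \<in> carrier_vec n" and Px: "?P *\<^sub>v x = 0\<^sub>v n" using mat_kernelD[OF Pc] by auto
    have "?P *\<^sub>v x = x - U *\<^sub>v (mat_adjoint U *\<^sub>v x)"
      using Uc Ua x assoc_mult_mat_vec[OF Uc Ua x] by (simp add: minus_mult_distrib_mat_vec[of _ n n])
    also have "\<dots> = x" unfolding z using Uc x by simp
    finally show "x = 0\<^sub>v n" using Px by simp
  qed
  ultimately have "vec_space.rank n ?P = n - k" using rank_plus_kernel_dim[OF Pc] by simp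
  then show ?thesis unfolding orth_projector_iff
    using hermitian_idempotent_compl[OF hermitian_idempotent_isometry_proj[OF U]] by simp
qed

section \<open>Orthonormal factorizations\<close>

definition mat_incl :: "nat \<Rightarrow> nat \<Rightarrow> complex mat" where
  "mat_incl a b = mat a b (\<lambda>(i, j). if i = j then 1 else 0)"

lemma mat_incl_carrier [simp]: "mat_incl a b \<in> carrier_mat a b"
  unfolding mat_incl_def by auto

lemma mat_incl_same: "mat_incl k k = 1\<^sub>m k"
  by (rule eq_matI, auto simp: mat_incl_def)

lemma mat_incl_mult: "k \<le> p \<Longrightarrow> mat_incl q p * mat_incl p k = mat_incl q k"
proof (rule eq_matI)
  fix i j assume kp: "k \<le> p" and "i < dim_row (mat_incl q k)" "j < dim_col (mat_incl q k)"
  then have i: "i < q" and j: "j < k" by (auto simp: mat_incl_def)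
  have "(mat_incl q p * mat_incl p k) $$ (i, j) = (\<Sum>l<p. mat_incl q p $$ (i, l) * mat_incl p k $$ (l, j))"
    by (rule index_mult_mat_sum[OF mat_incl_carrier mat_incl_carrier i j])
  also have "\<dots> = (\<Sum>l<p. if l = j then (if i = j then 1 else 0) else 0)"
    using i j kp by (intro sum.cong refl) (auto simp: mat_incl_def)
  also have "\<dots> = mat_incl q k $$ (i, j)" using i j kp by (simp add: mat_incl_def)
  finally show "(mat_incl q p * mat_incl p k) $$ (i, j) = mat_incl q k $$ (i, j)" .
qed (auto simp: mat_incl_def)

lemma isometry_mat_incl: "b \<le> a \<Longrightarrow> isometry a b (mat_incl a b)"
  unfolding isometry_iff_orthonormal by (auto simp: mat_incl_def if_distrib cong: if_cong)

definition append_col :: "complex mat \<Rightarrow> (nat \<Rightarrow> complex) \<Rightarrow> complex mat" where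
  "append_col U u = mat (dim_row U) (Suc (dim_col U)) (\<lambda>(i, j). if j < dim_col U then U $$ (i, j) else u i)"

lemma append_col_carrier: "U \<in> carrier_mat n k \<Longrightarrow> append_col U u \<in> carrier_mat n (Suc k)"
  unfolding append_col_def by auto

lemma index_append_col:
  "U \<in> carrier_mat n k \<Longrightarrow> i < n \<Longrightarrow> j < Suc k \<Longrightarrow>
    append_col U u $$ (i, j) = (if j < k then U $$ (i, j) else u i)"
  unfolding append_col_def by auto

lemma isometry_append_col:
  assumes U: "isometry n k U"
    and orth: "\<And>l. l < k \<Longrightarrow> (\<Sum>i<n. cnj (U $$ (i, l)) * u i) = 0"
    and unit: "(\<Sum>i<n. cnj (u i) * u i) = 1"
  shows "isometry n (Suc k) (append_col U u)"
  unfolding isometry_iff_orthonormal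
proof (intro conjI allI impI)
  have Uc: "U \<in> carrier_mat n k" and orthU: "\<And>i j. i < k \<Longrightarrow> j < k \<Longrightarrow>
      (\<Sum>l<n. cnj (U $$ (l, i)) * U $$ (l, j)) = (if i = j then 1 else 0)"
    using U unfolding isometry_iff_orthonormal by auto
  show "append_col U u \<in> carrier_mat n (Suc k)" by (rule append_col_carrier[OF Uc])
  have orth': "(\<Sum>i<n. cnj (u i) * U $$ (i, l)) = 0" if "l < k" for l
    using arg_cong[OF orth[OF that], of cnj] by (simp add: cnj_sum mult.commute)
  fix i j assume i: "i < Suc k" and j: "j < Suc k"
  have "(\<Sum>l<n. cnj (append_col U u $$ (l, i)) * append_col U u $$ (l, j))
      = (\<Sum>l<n. cnj (if i < k then U $$ (l, i) else u l) * (if j < k then U $$ (l, j) else u l))"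
    using i j by (intro sum.cong refl) (simp add: index_append_col[OF Uc])
  also have "\<dots> = (if i = j then 1 else 0)"
    using i j orthU orth orth' unit by (cases "i < k"; cases "j < k") auto
  finally show "(\<Sum>l<n. cnj (append_col U u $$ (l, i)) * append_col U u $$ (l, j)) = (if i = j then 1 else 0)" .
qed

lemma append_col_mult_mat_incl:
  assumes Uc: "U \<in> carrier_mat n k"
  shows "append_col U u * mat_incl (Suc k) k = U"
proof (rule eq_matI)
  fix i j assume "i < dim_row U" "j < dim_col U"
  then have i: "i < n" and j: "j < k" using Uc by auto
  have "(append_col U u * mat_incl (Suc k) k) $$ (i, j)
      = (\<Sum>l<Suc k. append_col U u $$ (i, l) * mat_incl (Suc k) k $$ (l, j))"
    by (rule index_mult_mat_sum[OF append_col_carrier[OF Uc] mat_incl_carrier i]) (use j in simp)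
  also have "\<dots> = (\<Sum>l<Suc k. if l = j then U $$ (i, j) else 0)"
    using i j by (intro sum.cong refl) (auto simp: index_append_col[OF Uc] mat_incl_def)
  also have "\<dots> = U $$ (i, j)" using j by simp
  finally show "(append_col U u * mat_incl (Suc k) k) $$ (i, j) = U $$ (i, j)" .
qed (use Uc in \<open>auto simp: append_col_def mat_incl_def\<close>)

lemma exists_normalizing_scalar:
  fixes a :: "nat \<Rightarrow> complex"
  assumes "i0 < n" "a i0 \<noteq> 0"
  obtains \<nu> where "\<nu> \<noteq> 0" "(\<Sum>i<n. cnj (a i / \<nu>) * (a i / \<nu>)) = 1"
proof -
  define s where "s = (\<Sum>i<n. (cmod (a i))\<^sup>2)"
  have "0 < (cmod (a i0))\<^sup>2" using assms by simp
  also have "\<dots> \<le> s" unfolding s_def using assms by (intro member_le_sum) auto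
  finally have s0: "0 < s" .
  define \<nu> where "\<nu> = complex_of_real (sqrt s)"
  have "cnj \<nu> * \<nu> = complex_of_real s" unfolding \<nu>_def using s0
    by (simp add: power2_eq_square[symmetric] of_real_power[symmetric] del: of_real_power)
  moreover have "(\<Sum>i<n. cnj (a i) * a i) = complex_of_real s"
    unfolding s_def of_real_sum
    by (rule sum.cong[OF refl], simp add: complex_norm_square mult.commute del: of_real_power)
  ultimately have "(\<Sum>i<n. cnj (a i / \<nu>) * (a i / \<nu>)) = 1"
    using s0 by (simp add: sum_divide_distrib[symmetric])
  moreover have "\<nu> \<noteq> 0" unfolding \<nu>_def using s0 by simp
  ultimately show ?thesis using that by blast
qed

lemma isometry_extend_one:
  assumes U: "isometry n k U" and kn: "k < n"
  obtains U' where "isometry n (Suc k) U'" "U = U' * mat_incl (Suc k) k"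
proof -
  have Uc: "U \<in> carrier_mat n k" using U unfolding isometry_def by auto
  have Ua: "mat_adjoint U \<in> carrier_mat k n" using Uc by simp
  have "0 < kernel_dim (mat_adjoint U)"
    using rank_plus_kernel_dim[OF Ua] rank_le_dim_row[OF Ua] kn by linarith
  then obtain x where "x \<in> mat_kernel (mat_adjoint U)" and x0: "x \<noteq> 0\<^sub>v n"
    by (rule kernel_nonzero_vec[OF Ua])
  then have x: "x \<in> carrier_vec n" and Ux: "mat_adjoint U *\<^sub>v x = 0\<^sub>v k" using mat_kernelD[OF Ua] by auto
  obtain i0 where i0: "i0 < n" "x $ i0 \<noteq> 0" using x x0 by (metis eq_vecI index_zero_vec carrier_vecD)
  obtain \<nu> where \<nu>: "\<nu> \<noteq> 0" and unit: "(\<Sum>i<n. cnj (x $ i / \<nu>) * (x $ i / \<nu>)) = 1"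
    by (rule exists_normalizing_scalar[of i0 n "\<lambda>i. x $ i", OF i0])
  have "(\<Sum>i<n. cnj (U $$ (i, l)) * (x $ i / \<nu>)) = 0" if l: "l < k" for l
  proof -
    have "(\<Sum>i<n. cnj (U $$ (i, l)) * x $ i) = (mat_adjoint U *\<^sub>v x) $ l"
      using index_mult_mat_vec_sum[OF Ua x l] Uc l by (auto intro!: sum.cong)
    then show ?thesis using Ux l by (simp add: sum_divide_distrib[symmetric])
  qed
  from isometry_append_col[OF U this unit] append_col_mult_mat_incl[OF Uc] that show ?thesis by metis
qed

lemma isometry_extend:
  assumes U: "isometry n k U" and kq: "k \<le> q" and qn: "q \<le> n"
  shows "\<exists>U'. isometry n q U' \<and> U = U' * mat_incl q k"
  using kq qn
proof (induction q rule: dec_induct)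
  case base
  then show ?case using U mat_incl_same[of k] by (auto simp: isometry_def)
next
  case (step q)
  then obtain U' where U': "isometry n q U'" and e: "U = U' * mat_incl q k" by auto
  obtain U'' where U'': "isometry n (Suc q) U''" and e2: "U' = U'' * mat_incl (Suc q) q"
    using isometry_extend_one[OF U'] step by auto
  have U''c: "U'' \<in> carrier_mat n (Suc q)" using U'' unfolding isometry_def by auto
  have "U = U'' * (mat_incl (Suc q) q * mat_incl q k)"
    unfolding e e2 by (rule assoc_mult_mat[OF U''c mat_incl_carrier mat_incl_carrier])
  then have "U = U'' * mat_incl (Suc q) k" using mat_incl_mult step by simp
  then show ?case using U'' by blast
qed

text \<open>Gram--Schmidt, one column at a time: after processing the first \<open>p\<close> columns of \<open>A\<close>
  we have an isometry \<open>U\<close> with \<open>A\<^sub>{<p} = U X\<close> and \<open>U = A\<^sub>{<p} Y\<close>. The next column splits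
  as its projection \<open>U c\<close> onto the range of \<open>U\<close> plus a residual orthogonal to it, which
  either vanishes or, normalized, becomes a new column of \<open>U\<close>.\<close>

lemma gram_schmidt_step_dependent:
  assumes A: "A \<in> carrier_mat n (Suc p)" and U: "isometry n k U"
    and X: "X \<in> carrier_mat k p" and Y: "Y \<in> carrier_mat p k"
    and hA: "\<And>i j. i < n \<Longrightarrow> j < p \<Longrightarrow> A $$ (i, j) = (\<Sum>l<k. U $$ (i, l) * X $$ (l, j))"
    and hU: "\<And>i j. i < n \<Longrightarrow> j < k \<Longrightarrow> U $$ (i, j) = (\<Sum>l<p. A $$ (i, l) * Y $$ (l, j))"
    and Ap: "\<And>i. i < n \<Longrightarrow> A $$ (i, p) = (\<Sum>l<k. U $$ (i, l) * c l)"
  shows "\<exists>k' U' X' Y'. k' \<le> Suc k \<and> isometry n k' U' \<and> X' \<in> carrier_mat k' (Suc p)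
    \<and> Y' \<in> carrier_mat (Suc p) k' \<and> A = U' * X' \<and> U' = A * Y'"
proof -
  have Uc: "U \<in> carrier_mat n k" using U unfolding isometry_def by auto
  define X' where "X' = mat k (Suc p) (\<lambda>(i, j). if j < p then X $$ (i, j) else c i)"
  define Y' where "Y' = mat (Suc p) k (\<lambda>(i, j). if i < p then Y $$ (i, j) else 0)"
  have X'c: "X' \<in> carrier_mat k (Suc p)" and Y'c: "Y' \<in> carrier_mat (Suc p) k"
    unfolding X'_def Y'_def by auto
  have eA: "A = U * X'"
  proof (rule eq_matI)
    fix i j assume "i < dim_row (U * X')" "j < dim_col (U * X')"
    then have i: "i < n" and j: "j < Suc p" using Uc X'c by auto
    have "(U * X') $$ (i, j) = (\<Sum>l<k. U $$ (i, l) * X' $$ (l, j))" by (rule index_mult_mat_sum[OF Uc X'c i j])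
    also have "\<dots> = A $$ (i, j)"
      using hA[OF i] Ap[OF i] j by (cases "j < p") (auto simp: X'_def less_Suc_eq)
    finally show "A $$ (i, j) = (U * X') $$ (i, j)" ..
  qed (insert A Uc X'c, auto)
  have eU: "U = A * Y'"
  proof (rule eq_matI)
    fix i j assume "i < dim_row (A * Y')" "j < dim_col (A * Y')"
    then have i: "i < n" and j: "j < k" using A Y'c by auto
    have "(A * Y') $$ (i, j) = (\<Sum>l<Suc p. A $$ (i, l) * Y' $$ (l, j))" by (rule index_mult_mat_sum[OF A Y'c i j])
    also have "\<dots> = (\<Sum>l<p. A $$ (i, l) * Y $$ (l, j))" using j by (simp add: Y'_def)
    finally show "U $$ (i, j) = (A * Y') $$ (i, j)" using hU[OF i j] by simp
  qed (insert A Uc Y'c, auto)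
  have "k \<le> Suc k" by simp
  show ?thesis
    by (rule exI[of _ k], rule exI[of _ U], rule exI[of _ X'], rule exI[of _ Y'], intro conjI, fact+)
qed

lemma gram_schmidt_step_independent:
  assumes A: "A \<in> carrier_mat n (Suc p)" and U: "isometry n k U"
    and X: "X \<in> carrier_mat k p" and Y: "Y \<in> carrier_mat p k"
    and hA: "\<And>i j. i < n \<Longrightarrow> j < p \<Longrightarrow> A $$ (i, j) = (\<Sum>l<k. U $$ (i, l) * X $$ (l, j))"
    and hU: "\<And>i j. i < n \<Longrightarrow> j < k \<Longrightarrow> U $$ (i, j) = (\<Sum>l<p. A $$ (i, l) * Y $$ (l, j))"
    and Ap: "\<And>i. i < n \<Longrightarrow> A $$ (i, p) = (\<Sum>l<k. U $$ (i, l) * c l) + \<nu> * u i" and \<nu>: "\<nu> \<noteq> 0"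
    and orth: "\<And>l. l < k \<Longrightarrow> (\<Sum>i<n. cnj (U $$ (i, l)) * u i) = 0"
    and unit: "(\<Sum>i<n. cnj (u i) * u i) = 1"
  shows "\<exists>k' U' X' Y'. k' \<le> Suc k \<and> isometry n k' U' \<and> X' \<in> carrier_mat k' (Suc p)
    \<and> Y' \<in> carrier_mat (Suc p) k' \<and> A = U' * X' \<and> U' = A * Y'"
proof -
  have Uc: "U \<in> carrier_mat n k" using U unfolding isometry_def by auto
  define U' where "U' = append_col U u"
  define X' where "X' = mat (Suc k) (Suc p) (\<lambda>(i, j).
    if i < k then (if j < p then X $$ (i, j) else c i) else (if j < p then 0 else \<nu>))"
  define S where "S i = (\<Sum>l<k. Y $$ (i, l) * c l)" for i
  define Y' where "Y' = mat (Suc p) (Suc k) (\<lambda>(i, j).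
    if j < k then (if i < p then Y $$ (i, j) else 0) else (if i < p then - S i / \<nu> else 1 / \<nu>))"
  have U'c: "U' \<in> carrier_mat n (Suc k)" and X'c: "X' \<in> carrier_mat (Suc k) (Suc p)"
    and Y'c: "Y' \<in> carrier_mat (Suc p) (Suc k)"
    unfolding U'_def X'_def Y'_def using append_col_carrier[OF Uc] by auto
  have U'i: "U' $$ (i, l) = (if l < k then U $$ (i, l) else u i)" if "i < n" "l < Suc k" for i l
    unfolding U'_def using index_append_col[OF Uc that] .
  have eA: "A = U' * X'"
  proof (rule eq_matI)
    fix i j assume "i < dim_row (U' * X')" "j < dim_col (U' * X')"
    then have i: "i < n" and j: "j < Suc p" using U'c X'c by auto
    have "(U' * X') $$ (i, j) = (\<Sum>l<Suc k. U' $$ (i, l) * X' $$ (l, j))"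
      by (rule index_mult_mat_sum[OF U'c X'c i j])
    also have "\<dots> = (\<Sum>l<k. U $$ (i, l) * X' $$ (l, j)) + u i * X' $$ (k, j)"
      using i by (simp add: U'i)
    also have "\<dots> = A $$ (i, j)"
      using hA[OF i] Ap[OF i] j by (cases "j < p") (auto simp: X'_def less_Suc_eq)
    finally show "A $$ (i, j) = (U' * X') $$ (i, j)" ..
  qed (insert A U'c X'c, auto)
  have eU: "U' = A * Y'"
  proof (rule eq_matI)
    fix i j assume "i < dim_row (A * Y')" "j < dim_col (A * Y')"
    then have i: "i < n" and j: "j < Suc k" using A Y'c by auto
    have "(A * Y') $$ (i, j) = (\<Sum>l<Suc p. A $$ (i, l) * Y' $$ (l, j))"
      by (rule index_mult_mat_sum[OF A Y'c i j])
    also have "\<dots> = (\<Sum>l<p. A $$ (i, l) * Y' $$ (l, j)) + A $$ (i, p) * Y' $$ (p, j)" by simp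
    also have "\<dots> = U' $$ (i, j)"
    proof (cases "j < k")
      case True
      then show ?thesis using hU[OF i True] i j by (simp add: Y'_def U'i)
    next
      case False
      then have jk: "j = k" using j by simp
      have "(\<Sum>l<p. A $$ (i, l) * S l) = (\<Sum>m<k. (\<Sum>l<p. A $$ (i, l) * Y $$ (l, m)) * c m)"
        unfolding S_def by (simp add: sum_distrib_left sum_distrib_right mult.assoc, rule sum.swap)
      also have "\<dots> = (\<Sum>m<k. U $$ (i, m) * c m)" using hU[OF i] by simp
      finally have "(\<Sum>l<p. A $$ (i, l) * Y' $$ (l, j)) = - (\<Sum>m<k. U $$ (i, m) * c m) / \<nu>"
        unfolding jk by (simp add: Y'_def sum_divide_distrib[symmetric] sum_negf)
      then show ?thesis using Ap[OF i] \<nu> i jk by (simp add: Y'_def U'i field_simps)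
    qed
    finally show "U' $$ (i, j) = (A * Y') $$ (i, j)" ..
  qed (insert A U'c Y'c, auto)
  have "isometry n (Suc k) U'" unfolding U'_def by (rule isometry_append_col[OF U orth unit])
  have "Suc k \<le> Suc k" by simp
  show ?thesis
    by (rule exI[of _ "Suc k"], rule exI[of _ U'], rule exI[of _ X'], rule exI[of _ Y'], intro conjI, fact+)
qed

lemma gram_schmidt_step:
  assumes A: "A \<in> carrier_mat n (Suc p)" and U: "isometry n k U"
    and X: "X \<in> carrier_mat k p" and Y: "Y \<in> carrier_mat p k"
    and hA: "\<And>i j. i < n \<Longrightarrow> j < p \<Longrightarrow> A $$ (i, j) = (\<Sum>l<k. U $$ (i, l) * X $$ (l, j))"
    and hU: "\<And>i j. i < n \<Longrightarrow> j < k \<Longrightarrow> U $$ (i, j) = (\<Sum>l<p. A $$ (i, l) * Y $$ (l, j))"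
  shows "\<exists>k' U' X' Y'. k' \<le> Suc k \<and> isometry n k' U' \<and> X' \<in> carrier_mat k' (Suc p)
    \<and> Y' \<in> carrier_mat (Suc p) k' \<and> A = U' * X' \<and> U' = A * Y'"
proof -
  have Uc: "U \<in> carrier_mat n k" using U unfolding isometry_def by auto
  have orthU: "\<And>i j. i < k \<Longrightarrow> j < k \<Longrightarrow> (\<Sum>l<n. cnj (U $$ (l, i)) * U $$ (l, j)) = (if i = j then 1 else 0)"
    using U unfolding isometry_iff_orthonormal by auto
  define c where "c l = (\<Sum>i<n. cnj (U $$ (i, l)) * A $$ (i, p))" for l
  define a where "a i = A $$ (i, p) - (\<Sum>l<k. U $$ (i, l) * c l)" for i
  have orth: "(\<Sum>i<n. cnj (U $$ (i, l)) * a i) = 0" if l: "l < k" for l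
  proof -
    have "(\<Sum>i<n. \<Sum>m<k. cnj (U $$ (i, l)) * U $$ (i, m) * c m)
        = (\<Sum>m<k. (\<Sum>i<n. cnj (U $$ (i, l)) * U $$ (i, m)) * c m)"
      by (subst sum.swap, simp add: sum_distrib_right)
    also have "\<dots> = (\<Sum>m<k. (if l = m then 1 else 0) * c m)" using orthU l by (intro sum.cong refl, auto)
    also have "\<dots> = (\<Sum>m<k. if m = l then c m else 0)" by (intro sum.cong refl, auto)
    also have "\<dots> = c l" using l by simp
    finally show ?thesis
      unfolding a_def c_def by (simp add: right_diff_distrib sum_subtractf sum_distrib_left mult.assoc)
  qed
  show ?thesis
  proof (cases "\<forall>i<n. a i = 0")
    case True
    then have "\<And>i. i < n \<Longrightarrow> A $$ (i, p) = (\<Sum>l<k. U $$ (i, l) * c l)" unfolding a_def by simp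
    from gram_schmidt_step_dependent[OF A U X Y hA hU this] show ?thesis .
  next
    case False
    then obtain i0 where "i0 < n" "a i0 \<noteq> 0" by auto
    then obtain \<nu> where \<nu>: "\<nu> \<noteq> 0" and unit: "(\<Sum>i<n. cnj (a i / \<nu>) * (a i / \<nu>)) = 1"
      by (rule exists_normalizing_scalar[of i0 n a])
    have Ap: "\<And>i. i < n \<Longrightarrow> A $$ (i, p) = (\<Sum>l<k. U $$ (i, l) * c l) + \<nu> * (a i / \<nu>)"
      using \<nu> unfolding a_def by simp
    have orth': "\<And>l. l < k \<Longrightarrow> (\<Sum>i<n. cnj (U $$ (i, l)) * (a i / \<nu>)) = 0"
      using orth by (simp add: sum_divide_distrib[symmetric])
    from gram_schmidt_step_independent[OF A U X Y hA hU Ap \<nu> orth' unit] show ?thesis .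
  qed
qed

lemma isometry_factorization:
  assumes "A \<in> carrier_mat n p"
  shows "\<exists>k U X Y. k \<le> p \<and> isometry n k U \<and> X \<in> carrier_mat k p \<and> Y \<in> carrier_mat p k
    \<and> A = U * X \<and> U = A * Y"
  using assms
proof (induction p arbitrary: A)
  case 0
  show ?case
    by (rule exI[of _ 0], rule exI[of _ "0\<^sub>m n 0"], rule exI[of _ "0\<^sub>m 0 0"], rule exI[of _ "0\<^sub>m 0 0"],
        use 0 in \<open>auto simp: isometry_iff_orthonormal intro!: eq_matI\<close>)
next
  case (Suc p)
  define A0 where "A0 = mat n p (\<lambda>(i, j). A $$ (i, j))"
  have A0c: "A0 \<in> carrier_mat n p" unfolding A0_def by auto
  from Suc.IH[OF A0c] obtain k U X Y where k: "k \<le> p" and U: "isometry n k U" and X: "X \<in> carrier_mat k p"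
    and Y: "Y \<in> carrier_mat p k" and eA: "A0 = U * X" and eU: "U = A0 * Y" by blast
  have Uc: "U \<in> carrier_mat n k" using U unfolding isometry_def by auto
  have hA: "A $$ (i, j) = (\<Sum>l<k. U $$ (i, l) * X $$ (l, j))" if i: "i < n" and j: "j < p" for i j
  proof -
    have "A $$ (i, j) = A0 $$ (i, j)" using i j unfolding A0_def by simp
    also have "\<dots> = (U * X) $$ (i, j)" using eA by simp
    also have "\<dots> = (\<Sum>l<k. U $$ (i, l) * X $$ (l, j))" by (rule index_mult_mat_sum[OF Uc X i j])
    finally show ?thesis .
  qed
  have hU: "U $$ (i, j) = (\<Sum>l<p. A $$ (i, l) * Y $$ (l, j))" if i: "i < n" and j: "j < k" for i j
  proof -
    have "U $$ (i, j) = (A0 * Y) $$ (i, j)" using eU by simp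
    also have "\<dots> = (\<Sum>l<p. A0 $$ (i, l) * Y $$ (l, j))" by (rule index_mult_mat_sum[OF A0c Y i j])
    also have "\<dots> = (\<Sum>l<p. A $$ (i, l) * Y $$ (l, j))" using i unfolding A0_def by (intro sum.cong refl, simp)
    finally show ?thesis .
  qed
  from gram_schmidt_step[OF Suc.prems U X Y hA hU] obtain k' U' X' Y' where "k' \<le> Suc k"
    "isometry n k' U'" "X' \<in> carrier_mat k' (Suc p)" "Y' \<in> carrier_mat (Suc p) k'" "A = U' * X'" "U' = A * Y'"
    by blast
  moreover have "k' \<le> Suc p" using k \<open>k' \<le> Suc k\<close> by simp
  ultimately show ?case by blast
qed

lemma isometry_factorization_wide:
  assumes A: "A \<in> carrier_mat n p" and pq: "p \<le> q" and qn: "q \<le> n"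
  obtains U X where "isometry n q U" "X \<in> carrier_mat q p" "A = U * X"
proof -
  from isometry_factorization[OF A] obtain k U0 X0 where k: "k \<le> p" and U0: "isometry n k U0"
    and X0: "X0 \<in> carrier_mat k p" and eA: "A = U0 * X0" by blast
  from isometry_extend[OF U0 _ qn] k pq obtain U where U: "isometry n q U" and eU: "U0 = U * mat_incl q k"
    by auto
  have "U \<in> carrier_mat n q" using U unfolding isometry_def by auto
  then have "A = U * (mat_incl q k * X0)" unfolding eA eU by (rule assoc_mult_mat[OF _ mat_incl_carrier X0])
  with U X0 that show ?thesis by (metis mat_incl_carrier mult_carrier_mat)
qed

lemma rank_factorization:
  assumes A: "(A :: complex mat) \<in> carrier_mat n p"
  obtains Z Q where "Z \<in> carrier_mat n (vec_space.rank n A)" "Q \<in> carrier_mat (vec_space.rank n A) p"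
    "A = Z * Q"
proof -
  let ?r = "vec_space.rank n A"
  from isometry_factorization[OF A] obtain k V X Y where V: "isometry n k V" and X: "X \<in> carrier_mat k p"
    and Y: "Y \<in> carrier_mat p k" and eA: "A = V * X" and eV: "V = A * Y" by blast
  have Vc: "V \<in> carrier_mat n k" using V unfolding isometry_def by auto
  have "k \<le> ?r" using isometry_rank[OF V] rank_mult_le_left[OF A Y] eV by simp
  then have JJ: "mat_adjoint (mat_incl ?r k) * mat_incl ?r k = 1\<^sub>m k"
    using isometry_mat_incl unfolding isometry_def by blast
  let ?J = "mat_incl ?r k"
  have Ja: "mat_adjoint ?J \<in> carrier_mat k ?r" by simp
  have "V * mat_adjoint ?J * (?J * X) = V * (mat_adjoint ?J * (?J * X))"
    by (rule assoc_mult_mat[OF Vc Ja mult_carrier_mat[OF mat_incl_carrier X]])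
  also have "mat_adjoint ?J * (?J * X) = (mat_adjoint ?J * ?J) * X"
    by (rule assoc_mult_mat[OF Ja mat_incl_carrier X, symmetric])
  also have "V * (\<dots>) = V * X" unfolding JJ using X by simp
  also have "\<dots> = A" by (rule eA[symmetric])
  finally show ?thesis using that Vc X by (metis mat_adjoint_carrier mat_incl_carrier mult_carrier_mat)
qed

lemma isometry_onto_kernel:
  assumes P: "orth_projector n r P"
  obtains B where "isometry n (n - r) B" "P * B = 0\<^sub>m n (n - r)"
proof -
  have Pc: "P \<in> carrier_mat n n" and i: "P * P = P" and rk: "vec_space.rank n P = r"
    using P unfolding orth_projector_def by auto
  define E where "E = 1\<^sub>m n - P"
  have Ec: "E \<in> carrier_mat n n" unfolding E_def using Pc by auto
  from isometry_factorization[OF Ec] obtain k U X Y where U: "isometry n k U" and X: "X \<in> carrier_mat k n"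
    and Y: "Y \<in> carrier_mat n k" and eE: "E = U * X" and eU: "U = E * Y" by blast
  have Uc: "U \<in> carrier_mat n k" and UI: "mat_adjoint U * U = 1\<^sub>m k" using U unfolding isometry_def by auto
  have "P * E = 0\<^sub>m n n"
    unfolding E_def using Pc i by (simp add: mult_minus_distrib_mat[OF Pc one_carrier_mat Pc])
  then have PU: "P * U = 0\<^sub>m n k" unfolding eU using Y by (simp add: assoc_mult_mat[OF Pc Ec Y, symmetric])
  have "n - r \<le> k"
  proof -
    have "kernel_dim P \<le> k"
    proof (rule kernel_dim_le_of_inj[OF Pc mat_adjoint_carrier[OF Uc]])
      fix x assume "x \<in> mat_kernel P" and z: "mat_adjoint U *\<^sub>v x = 0\<^sub>v k"
      then have x: "x \<in> carrier_vec n" and Px: "P *\<^sub>v x = 0\<^sub>v n" using mat_kernelD[OF Pc] by auto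
      have Ex: "E *\<^sub>v x = x" unfolding E_def using Pc x Px by (simp add: minus_mult_distrib_mat_vec[of _ n n])
      have Xx: "X *\<^sub>v x \<in> carrier_vec k" using X x by auto
      have "X *\<^sub>v x = (mat_adjoint U * U) *\<^sub>v (X *\<^sub>v x)" unfolding UI using Xx by simp
      also have "\<dots> = mat_adjoint U *\<^sub>v (E *\<^sub>v x)"
        unfolding eE using Uc X x by (simp add: assoc_mult_mat_vec[of _ k n _ k])
      finally have "X *\<^sub>v x = 0\<^sub>v k" unfolding Ex z .
      then show "x = 0\<^sub>v n" using Ex Uc X x unfolding eE by (simp add: assoc_mult_mat_vec[of _ n k _ n])
    qed
    then show ?thesis using rank_plus_kernel_dim[OF Pc] rk by simp
  qed
  define B where "B = U * mat_incl k (n - r)"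
  have "isometry n (n - r) B"
    unfolding B_def using isometry_mult[OF U isometry_mat_incl[OF \<open>n - r \<le> k\<close>]] .
  moreover have "P * B = 0\<^sub>m n (n - r)"
    unfolding B_def using assoc_mult_mat[OF Pc Uc mat_incl_carrier, symmetric] PU
    by (simp add: left_mult_zero_mat[OF mat_incl_carrier])
  ultimately show ?thesis by (rule that)
qed

section \<open>The Hamiltonian and the network map\<close>

lemma gqsat3_H_eq_kron:
  assumes P1: "P1 \<in> carrier_mat (d1 * d2) (d1 * d2)" and P2: "P2 \<in> carrier_mat (d2 * d3) (d2 * d3)"
    and d2: "0 < d2" and d3: "0 < d3"
  shows "gqsat3_H d1 d2 d3 P1 P2 = kron_id_right d3 P1 + kron_id_left d1 P2"
proof (rule eq_matI)
  fix i j assume "i < dim_row (kron_id_right d3 P1 + kron_id_left d1 P2)"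
    "j < dim_col (kron_id_right d3 P1 + kron_id_left d1 P2)"
  then have i: "i < d1 * d2 * d3" and j: "j < d1 * d2 * d3" using P1 P2 by auto
  then have i2: "i < d1 * (d2 * d3)" and j2: "j < d1 * (d2 * d3)" by (auto simp: mult.assoc)
  have e1: "i div (d2 * d3) * d2 + i div d3 mod d2 = i div d3" for i
    by (metis div_mult2_eq div_mult_mod_eq mult.commute)
  have e2: "i div d3 mod d2 * d3 + i mod d3 = i mod (d2 * d3)" for i
    by (metis add.commute mod_mult2_eq mult.commute)
  show "gqsat3_H d1 d2 d3 P1 P2 $$ (i, j) = (kron_id_right d3 P1 + kron_id_left d1 P2) $$ (i, j)"
    unfolding gqsat3_H_def using i j P1 P2
    by (simp add: Let_def index_kron_id_right[OF P1 i j] index_kron_id_left[OF P2 i2 j2] e1 e2)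
qed (insert P1 P2, auto simp: gqsat3_H_def mult.assoc)

lemma index_kron_network:
  assumes Q: "Q \<in> carrier_mat r (d2 * d3)" and B: "B \<in> carrier_mat (d1 * d2) m"
    and i: "i < d1 * r" and j: "j < m * d3"
  shows "(kron_id_left d1 Q * kron_id_right d3 B) $$ (i, j)
    = (\<Sum>k<d2. Q $$ (i mod r, k * d3 + j mod d3) * B $$ (i div r * d2 + k, j div d3))"
proof -
  have r: "0 < r" and d3: "0 < d3" using i j by (auto intro: ccontr)
  have ir: "i div r < d1" using i by (simp add: less_mult_imp_div_less mult.commute)
  have jd: "j mod d3 < d3" using d3 by simp
  have KB: "kron_id_right d3 B \<in> carrier_mat (d1 * (d2 * d3)) (m * d3)"
    using kron_id_right_carrier[OF B] by (simp add: mult.assoc)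
  let ?F = "\<lambda>k. Q $$ (i mod r, k * d3 + j mod d3) * B $$ (i div r * d2 + k, j div d3)"
  have "(kron_id_left d1 Q * kron_id_right d3 B) $$ (i, j)
      = (\<Sum>l<d1 * (d2 * d3). kron_id_left d1 Q $$ (i, l) * kron_id_right d3 B $$ (l, j))"
    by (rule index_mult_mat_sum[OF kron_id_left_carrier[OF Q] KB i j])
  also have "\<dots> = (\<Sum>p<d1. \<Sum>k<d2. \<Sum>c<d3. kron_id_left d1 Q $$ (i, p * (d2 * d3) + (k * d3 + c))
      * kron_id_right d3 B $$ (p * (d2 * d3) + (k * d3 + c), j))"
    by (simp add: sum_lessThan_mult)
  also have "\<dots> = (\<Sum>p<d1. \<Sum>k<d2. \<Sum>c<d3. if p = i div r \<and> c = j mod d3 then ?F k else 0)"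
  proof (intro sum.cong refl)
    fix p k c assume p: "p \<in> {..<d1}" and k: "k \<in> {..<d2}" and c: "c \<in> {..<d3}"
    let ?l = "p * (d2 * d3) + (k * d3 + c)"
    have s: "k * d3 + c < d2 * d3" using k c by (simp add: mult_add_less_mult)
    have l2: "?l < d1 * (d2 * d3)" using p s by (simp add: mult_add_less_mult)
    have l1: "?l < d1 * d2 * d3" using l2 by (simp add: mult.assoc)
    have dv: "?l div (d2 * d3) = p" "?l mod (d2 * d3) = k * d3 + c" using mult_add_div_mod[OF s] by auto
    have e: "?l = (p * d2 + k) * d3 + c" by (simp add: algebra_simps)
    have dv3: "?l div d3 = p * d2 + k" "?l mod d3 = c"
      unfolding e using mult_add_div_mod[of c d3 "p * d2 + k"] c by auto
    show "kron_id_left d1 Q $$ (i, ?l) * kron_id_right d3 B $$ (?l, j)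
      = (if p = i div r \<and> c = j mod d3 then ?F k else 0)"
      using index_kron_id_left[OF Q i l2] index_kron_id_right[OF B l1 j] dv dv3 by auto
  qed
  also have "\<dots> = (\<Sum>p<d1. \<Sum>k<d2. if p = i div r then ?F k else 0)"
    using jd by (intro sum.cong refl) (simp add: sum.delta)
  also have "\<dots> = (\<Sum>k<d2. \<Sum>p<d1. if p = i div r then ?F k else 0)" by (rule sum.swap)
  also have "\<dots> = (\<Sum>k<d2. ?F k)" using ir by simp
  finally show ?thesis .
qed

text \<open>The tensor at \<open>x\<close> read as a map \<open>B : \<complex>\<^sup>m \<rightarrow> \<complex>\<^sup>d\<^sup>1 \<otimes> \<complex>\<^sup>d\<^sup>2\<close> from edge \<open>s\<^sub>1x\<close> to
  edges \<open>xt\<^sub>1, xy\<close>, and the tensor at \<open>y\<close> read as a map \<open>Q : \<complex>\<^sup>d\<^sup>2 \<otimes> \<complex>\<^sup>d\<^sup>3 \<rightarrow> \<complex>\<^sup>r\<^sup>2\<close> from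
  edges \<open>xy, s\<^sub>2y\<close> to edge \<open>yt\<^sub>2\<close>.\<close>

definition vertex_x_mat :: "nat \<Rightarrow> nat \<Rightarrow> nat \<Rightarrow> (nat \<Rightarrow> nat \<Rightarrow> nat \<Rightarrow> complex) \<Rightarrow> complex mat" where
  "vertex_x_mat m d1 d2 Tx = mat (d1 * d2) m (\<lambda>(u, s). Tx s (u div d2) (u mod d2))"

definition vertex_y_mat :: "nat \<Rightarrow> nat \<Rightarrow> nat \<Rightarrow> (nat \<Rightarrow> nat \<Rightarrow> nat \<Rightarrow> complex) \<Rightarrow> complex mat" where
  "vertex_y_mat r2 d2 d3 Ty = mat r2 (d2 * d3) (\<lambda>(t, v). Ty (v div d3) (v mod d3) t)"

lemma dim_vertex_mat [simp]:
  "dim_row (vertex_x_mat m d1 d2 Tx) = d1 * d2" "dim_col (vertex_x_mat m d1 d2 Tx) = m"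
  "dim_row (vertex_y_mat r2 d2 d3 Ty) = r2" "dim_col (vertex_y_mat r2 d2 d3 Ty) = d2 * d3"
  unfolding vertex_x_mat_def vertex_y_mat_def by auto

lemma vertex_mat_carrier [simp]:
  "vertex_x_mat m d1 d2 Tx \<in> carrier_mat (d1 * d2) m"
  "vertex_y_mat r2 d2 d3 Ty \<in> carrier_mat r2 (d2 * d3)"
  unfolding vertex_x_mat_def vertex_y_mat_def by auto

lemma index_vertex_x_mat:
  "t < d1 \<Longrightarrow> k < d2 \<Longrightarrow> s < m \<Longrightarrow> vertex_x_mat m d1 d2 Tx $$ (t * d2 + k, s) = Tx s t k"
  by (simp add: vertex_x_mat_def mult_add_less_mult mult_add_div_mod)

lemma index_vertex_y_mat:
  "t < r2 \<Longrightarrow> k < d2 \<Longrightarrow> c < d3 \<Longrightarrow> vertex_y_mat r2 d2 d3 Ty $$ (t, k * d3 + c) = Ty k c t"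
  by (simp add: vertex_y_mat_def mult_add_less_mult mult_add_div_mod)

lemma vertex_x_mat_of_mat:
  "B \<in> carrier_mat (d1 * d2) m \<Longrightarrow> vertex_x_mat m d1 d2 (\<lambda>s t k. B $$ (t * d2 + k, s)) = B"
  by (rule eq_matI) (auto simp: vertex_x_mat_def)

lemma vertex_y_mat_of_mat:
  "Q \<in> carrier_mat r2 (d2 * d3) \<Longrightarrow> vertex_y_mat r2 d2 d3 (\<lambda>k c t. Q $$ (t, k * d3 + c)) = Q"
  by (rule eq_matI) (auto simp: vertex_y_mat_def)

lemma G3_beta_eq_kron:
  "G3_beta m d1 d2 d3 r2 Tx Ty
    = kron_id_left d1 (vertex_y_mat r2 d2 d3 Ty) * kron_id_right d3 (vertex_x_mat m d1 d2 Tx)"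
proof (rule eq_matI)
  fix i j assume "i < dim_row (kron_id_left d1 (vertex_y_mat r2 d2 d3 Ty) * kron_id_right d3 (vertex_x_mat m d1 d2 Tx))"
    "j < dim_col (kron_id_left d1 (vertex_y_mat r2 d2 d3 Ty) * kron_id_right d3 (vertex_x_mat m d1 d2 Tx))"
  then have i: "i < d1 * r2" and j: "j < m * d3" by auto
  then have "0 < r2" "0 < d3" by (auto intro: ccontr)
  then have ir: "i div r2 < d1" "i mod r2 < r2" and jd: "j div d3 < m" "j mod d3 < d3"
    using i j by (auto simp: less_mult_imp_div_less mult.commute)
  have "G3_beta m d1 d2 d3 r2 Tx Ty $$ (i, j) = (\<Sum>k<d2. Tx (j div d3) (i div r2) k * Ty k (j mod d3) (i mod r2))"
    unfolding G3_beta_def using i j by simp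
  also have "\<dots> = (\<Sum>k<d2. vertex_y_mat r2 d2 d3 Ty $$ (i mod r2, k * d3 + j mod d3)
      * vertex_x_mat m d1 d2 Tx $$ (i div r2 * d2 + k, j div d3))"
    using ir jd by (intro sum.cong refl) (simp add: index_vertex_x_mat index_vertex_y_mat)
  also have "\<dots> = (kron_id_left d1 (vertex_y_mat r2 d2 d3 Ty) * kron_id_right d3 (vertex_x_mat m d1 d2 Tx)) $$ (i, j)"
    by (rule index_kron_network[OF vertex_mat_carrier(2) vertex_mat_carrier(1) i j, symmetric])
  finally show "G3_beta m d1 d2 d3 r2 Tx Ty $$ (i, j)
    = (kron_id_left d1 (vertex_y_mat r2 d2 d3 Ty) * kron_id_right d3 (vertex_x_mat m d1 d2 Tx)) $$ (i, j)" .
qed (auto simp: G3_beta_def)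

lemma kernel_dim_network_le_hamiltonian:
  fixes B P1 Z Q :: "complex mat"
  assumes B: "isometry n1 m B" and P1: "P1 \<in> carrier_mat n1 n1" and P1B: "P1 * B = 0\<^sub>m n1 m"
    and Z: "Z \<in> carrier_mat n2 r" and Q: "Q \<in> carrier_mat r n2"
    and N: "n1 * d3 = d1 * n2" and d3: "0 < d3"
  shows "kernel_dim (kron_id_left d1 Q * kron_id_right d3 B)
    \<le> kernel_dim (kron_id_right d3 P1 + kron_id_left d1 (Z * Q))"
proof -
  have Bc: "B \<in> carrier_mat n1 m" using B unfolding isometry_def by auto
  have KB: "kron_id_right d3 B \<in> carrier_mat (n1 * d3) (m * d3)" using Bc by simp
  have KQ: "kron_id_left d1 Q \<in> carrier_mat (d1 * r) (n1 * d3)" using Q N by simp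
  have KZ: "kron_id_left d1 Z \<in> carrier_mat (n1 * d3) (d1 * r)" using Z N by simp
  have KP1: "kron_id_right d3 P1 \<in> carrier_mat (n1 * d3) (n1 * d3)" using P1 by simp
  let ?\<beta> = "kron_id_left d1 Q * kron_id_right d3 B"
  let ?H = "kron_id_right d3 P1 + kron_id_left d1 Z * kron_id_left d1 Q"
  have \<beta>c: "?\<beta> \<in> carrier_mat (d1 * r) (m * d3)" using KQ KB by auto
  have Hc: "?H \<in> carrier_mat (n1 * d3) (n1 * d3)" using KP1 KZ KQ by auto
  have "kernel_dim ?\<beta> \<le> kernel_dim ?H"
  proof (rule kernel_dim_le_via_inj[OF \<beta>c Hc KB])
    fix w assume "w \<in> mat_kernel ?\<beta>"
    then have w: "w \<in> carrier_vec (m * d3)" and \<beta>w: "?\<beta> *\<^sub>v w = 0\<^sub>v (d1 * r)"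
      using mat_kernelD[OF \<beta>c] by auto
    have v: "kron_id_right d3 B *\<^sub>v w \<in> carrier_vec (n1 * d3)" using KB w by auto
    have "kron_id_right d3 P1 *\<^sub>v (kron_id_right d3 B *\<^sub>v w) = kron_id_right d3 (P1 * B) *\<^sub>v w"
      using kron_id_right_mult[OF P1 Bc d3] KP1 KB w by simp
    also have "\<dots> = 0\<^sub>v (n1 * d3)" unfolding P1B kron_id_right_zero using w by auto
    finally have z1: "kron_id_right d3 P1 *\<^sub>v (kron_id_right d3 B *\<^sub>v w) = 0\<^sub>v (n1 * d3)" .
    have "(kron_id_left d1 Z * kron_id_left d1 Q) *\<^sub>v (kron_id_right d3 B *\<^sub>v w)
        = kron_id_left d1 Z *\<^sub>v (?\<beta> *\<^sub>v w)"
      using KZ KQ KB w by (simp add: assoc_mult_mat_vec[of _ "n1 * d3" "d1 * r"])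
    also have "\<dots> = 0\<^sub>v (n1 * d3)" unfolding \<beta>w using KZ by simp
    finally have z2: "(kron_id_left d1 Z * kron_id_left d1 Q) *\<^sub>v (kron_id_right d3 B *\<^sub>v w) = 0\<^sub>v (n1 * d3)" .
    have "?H *\<^sub>v (kron_id_right d3 B *\<^sub>v w) = 0\<^sub>v (n1 * d3)"
      using add_mult_distrib_mat_vec[OF KP1 mult_carrier_mat[OF KZ KQ] v] z1 z2 by simp
    then show "kron_id_right d3 B *\<^sub>v w \<in> mat_kernel ?H" using Hc v by (auto intro: mat_kernelI)
  next
    fix w assume "w \<in> mat_kernel ?\<beta>" and "kron_id_right d3 B *\<^sub>v w = 0\<^sub>v (n1 * d3)"
    then show "w = 0\<^sub>v (m * d3)"
      using mat_kernelD[OF \<beta>c] isometry_mult_vec_eq_0[OF kron_id_right_isometry[OF B d3]] by auto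
  qed
  then show ?thesis using kron_id_left_mult[OF Z Q] by simp
qed

lemma kron_isometry_left_inverse:
  assumes U: "isometry n m U" and d: "0 < d" and v: "v \<in> carrier_vec (n * d)"
    and z: "kron_id_right d (1\<^sub>m n - U * mat_adjoint U) *\<^sub>v v = 0\<^sub>v (n * d)"
  shows "kron_id_right d U *\<^sub>v (kron_id_right d (mat_adjoint U) *\<^sub>v v) = v"
proof -
  have Uc: "U \<in> carrier_mat n m" using U unfolding isometry_def by auto
  let ?\<Pi> = "1\<^sub>m n - U * mat_adjoint U"
  have \<Pi>c: "?\<Pi> \<in> carrier_mat n n" using Uc by auto
  have "kron_id_right d U * kron_id_right d (mat_adjoint U) = kron_id_right d (U * mat_adjoint U)"
    by (rule kron_id_right_mult[OF Uc mat_adjoint_carrier[OF Uc] d, symmetric])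
  also have "U * mat_adjoint U = 1\<^sub>m n - ?\<Pi>" using Uc by (intro eq_matI) auto
  also have "kron_id_right d \<dots> = 1\<^sub>m (n * d) - kron_id_right d ?\<Pi>"
    unfolding kron_id_right_minus[OF one_carrier_mat \<Pi>c] kron_id_right_one[OF d] ..
  finally have UU: "kron_id_right d U * kron_id_right d (mat_adjoint U) = 1\<^sub>m (n * d) - kron_id_right d ?\<Pi>" .
  have K\<Pi>: "kron_id_right d ?\<Pi> \<in> carrier_mat (n * d) (n * d)" using \<Pi>c by simp
  have "kron_id_right d U *\<^sub>v (kron_id_right d (mat_adjoint U) *\<^sub>v v) = (1\<^sub>m (n * d) - kron_id_right d ?\<Pi>) *\<^sub>v v"
    unfolding UU[symmetric] using Uc v by (intro assoc_mult_mat_vec[symmetric]) auto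
  also have "\<dots> = v" using v K\<Pi> z by (simp add: minus_mult_distrib_mat_vec[OF one_carrier_mat K\<Pi> v])
  finally show ?thesis .
qed

lemma isometry_adjoint_mult_proj:
  assumes V: "isometry n r V"
  shows "mat_adjoint V * (V * mat_adjoint V) = mat_adjoint V"
proof -
  have Vc: "V \<in> carrier_mat n r" and VI: "mat_adjoint V * V = 1\<^sub>m r" using V unfolding isometry_def by auto
  show ?thesis
    using assoc_mult_mat[OF mat_adjoint_carrier[OF Vc] Vc mat_adjoint_carrier[OF Vc], symmetric] VI
      left_mult_one_mat[OF mat_adjoint_carrier[OF Vc]] by simp
qed

text \<open>A vector in the kernel of \<open>H\<close> is fixed by \<open>U U\<^sup>* \<otimes> 1\<close> and killed by \<open>1 \<otimes> V V\<^sup>*\<close>,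
  so \<open>U\<^sup>* \<otimes> 1\<close> maps the kernel of \<open>H\<close> injectively into that of the network.\<close>

lemma kernel_dim_hamiltonian_le_network:
  assumes U: "isometry n1 m U" and V: "isometry n2 r V"
    and N: "n1 * d3 = d1 * n2" and d3: "0 < d3"
  shows "kernel_dim (kron_id_right d3 (1\<^sub>m n1 - U * mat_adjoint U) + kron_id_left d1 (V * mat_adjoint V))
    \<le> kernel_dim (kron_id_left d1 (mat_adjoint V) * kron_id_right d3 U)"
proof -
  have Uc: "U \<in> carrier_mat n1 m" and Vc: "V \<in> carrier_mat n2 r" using U V unfolding isometry_def by auto
  let ?\<Pi>1 = "1\<^sub>m n1 - U * mat_adjoint U" and ?\<Pi>2 = "V * mat_adjoint V" and ?N = "n1 * d3"
  have h1: "hermitian_idempotent ?N (kron_id_right d3 ?\<Pi>1)"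
    by (rule kron_id_right_hermitian_idempotent[OF hermitian_idempotent_compl[OF
          hermitian_idempotent_isometry_proj[OF U]] d3])
  have h2: "hermitian_idempotent ?N (kron_id_left d1 ?\<Pi>2)"
    using kron_id_left_hermitian_idempotent[OF hermitian_idempotent_isometry_proj[OF V], of d1] N by simp
  have KP1: "kron_id_right d3 ?\<Pi>1 \<in> carrier_mat ?N ?N" and KP2: "kron_id_left d1 ?\<Pi>2 \<in> carrier_mat ?N ?N"
    using h1 h2 unfolding hermitian_idempotent_def by auto
  have KU: "kron_id_right d3 U \<in> carrier_mat ?N (m * d3)" using Uc by simp
  have KUa: "kron_id_right d3 (mat_adjoint U) \<in> carrier_mat (m * d3) ?N" using Uc by simp
  have KVa: "kron_id_left d1 (mat_adjoint V) \<in> carrier_mat (d1 * r) ?N" using Vc N by simp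
  let ?H = "kron_id_right d3 ?\<Pi>1 + kron_id_left d1 ?\<Pi>2"
  let ?\<beta> = "kron_id_left d1 (mat_adjoint V) * kron_id_right d3 U"
  have Hc: "?H \<in> carrier_mat ?N ?N" using KP1 KP2 by auto
  have \<beta>c: "?\<beta> \<in> carrier_mat (d1 * r) (m * d3)" using KVa KU by auto
  have left_inv: "kron_id_right d3 U *\<^sub>v (kron_id_right d3 (mat_adjoint U) *\<^sub>v v) = v"
    if "v \<in> mat_kernel ?H" for v
  proof -
    from that have v: "v \<in> carrier_vec ?N" and "?H *\<^sub>v v = 0\<^sub>v ?N" using mat_kernelD[OF Hc] by auto
    then show ?thesis by (intro kron_isometry_left_inverse[OF U d3 v] hermitian_idempotent_add_kernel[OF h1 h2])
  qed
  have VaP2: "kron_id_left d1 (mat_adjoint V) * kron_id_left d1 ?\<Pi>2 = kron_id_left d1 (mat_adjoint V)"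
    using kron_id_left_mult[OF mat_adjoint_carrier[OF Vc] mult_carrier_mat[OF Vc mat_adjoint_carrier[OF Vc]]]
      isometry_adjoint_mult_proj[OF V] by simp
  show ?thesis
  proof (rule kernel_dim_le_via_inj[OF Hc \<beta>c KUa])
    fix v assume vk: "v \<in> mat_kernel ?H"
    then have v: "v \<in> carrier_vec ?N" and Hv: "?H *\<^sub>v v = 0\<^sub>v ?N" using mat_kernelD[OF Hc] by auto
    have z2: "kron_id_left d1 ?\<Pi>2 *\<^sub>v v = 0\<^sub>v ?N"
      by (rule hermitian_idempotent_add_kernel[OF h2 h1 v], subst comm_add_mat[OF KP2 KP1], rule Hv)
    have KUav: "kron_id_right d3 (mat_adjoint U) *\<^sub>v v \<in> carrier_vec (m * d3)" using KUa v by simp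
    have "?\<beta> *\<^sub>v (kron_id_right d3 (mat_adjoint U) *\<^sub>v v)
        = kron_id_left d1 (mat_adjoint V) *\<^sub>v (kron_id_right d3 U *\<^sub>v (kron_id_right d3 (mat_adjoint U) *\<^sub>v v))"
      by (rule assoc_mult_mat_vec[OF KVa KU KUav])
    also have "\<dots> = kron_id_left d1 (mat_adjoint V) *\<^sub>v v" by (simp only: left_inv[OF vk])
    also have "\<dots> = (kron_id_left d1 (mat_adjoint V) * kron_id_left d1 ?\<Pi>2) *\<^sub>v v" by (simp only: VaP2)
    also have "\<dots> = kron_id_left d1 (mat_adjoint V) *\<^sub>v (kron_id_left d1 ?\<Pi>2 *\<^sub>v v)"
      by (rule assoc_mult_mat_vec[OF KVa KP2 v])
    also have "\<dots> = 0\<^sub>v (d1 * r)" unfolding z2 using KVa by simp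
    finally show "kron_id_right d3 (mat_adjoint U) *\<^sub>v v \<in> mat_kernel ?\<beta>"
      using \<beta>c KUa v by (auto intro: mat_kernelI)
  next
    fix v assume vk: "v \<in> mat_kernel ?H" and z: "kron_id_right d3 (mat_adjoint U) *\<^sub>v v = 0\<^sub>v (m * d3)"
    have "v = kron_id_right d3 U *\<^sub>v (kron_id_right d3 (mat_adjoint U) *\<^sub>v v)" by (rule left_inv[OF vk, symmetric])
    also have "\<dots> = 0\<^sub>v ?N" unfolding z using KU by simp
    finally show "v = 0\<^sub>v ?N" .
  qed
qed

lemma rank_network_mono:
  assumes B: "B \<in> carrier_mat n1 m" and X: "X \<in> carrier_mat m m'"
    and Q: "(Q :: complex mat) \<in> carrier_mat r n2" and Y: "Y \<in> carrier_mat r' r"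
    and N: "n1 * d3 = d1 * n2" and d3: "0 < d3"
  shows "vec_space.rank (d1 * r') (kron_id_left d1 (Y * Q) * kron_id_right d3 (B * X))
    \<le> vec_space.rank (d1 * r) (kron_id_left d1 Q * kron_id_right d3 B)"
proof -
  have KY: "kron_id_left d1 Y \<in> carrier_mat (d1 * r') (d1 * r)" using Y by simp
  have KQ: "kron_id_left d1 Q \<in> carrier_mat (d1 * r) (n1 * d3)" using Q N by simp
  have KB: "kron_id_right d3 B \<in> carrier_mat (n1 * d3) (m * d3)" using B by simp
  have KX: "kron_id_right d3 X \<in> carrier_mat (m * d3) (m' * d3)" using X by simp
  have \<beta>: "kron_id_left d1 Q * kron_id_right d3 B \<in> carrier_mat (d1 * r) (m * d3)" using KQ KB by auto
  have "kron_id_left d1 (Y * Q) * kron_id_right d3 (B * X)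
      = kron_id_left d1 Y * ((kron_id_left d1 Q * kron_id_right d3 B) * kron_id_right d3 X)"
    unfolding kron_id_left_mult[OF Y Q] kron_id_right_mult[OF B X d3]
    using assoc_mult_mat[OF KY KQ mult_carrier_mat[OF KB KX]] assoc_mult_mat[OF KQ KB KX] by simp
  also have "vec_space.rank (d1 * r') \<dots> \<le> vec_space.rank (d1 * r) ((kron_id_left d1 Q * kron_id_right d3 B) * kron_id_right d3 X)"
    by (rule rank_mult_le_right[OF KY mult_carrier_mat[OF \<beta> KX]])
  also have "\<dots> \<le> vec_space.rank (d1 * r) (kron_id_left d1 Q * kron_id_right d3 B)"
    by (rule rank_mult_le_left[OF \<beta> KX])
  finally show ?thesis .
qed

lemma hamiltonian_kernel_plus_network_rank_le:
  fixes d1 d2 d3 r1 r2 :: nat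
  assumes d2: "0 < d2" and d3: "0 < d3" and r1: "r1 \<le> d1 * d2" and r2: "r2 \<le> d2 * d3"
  shows "\<exists>P1 P2. orth_projector (d1 * d2) r1 P1 \<and> orth_projector (d2 * d3) r2 P2 \<and>
    kernel_dim (gqsat3_H d1 d2 d3 P1 P2) + vec_space.rank (d1 * r2) (G3_beta (d1 * d2 - r1) d1 d2 d3 r2 Tx Ty)
      \<le> (d1 * d2 - r1) * d3"
proof -
  define m where "m = d1 * d2 - r1"
  let ?B = "vertex_x_mat m d1 d2 Tx" and ?Q = "vertex_y_mat r2 d2 d3 Ty"
  have N: "d1 * d2 * d3 = d1 * (d2 * d3)" by (simp add: mult.assoc)
  have "m \<le> d1 * d2" unfolding m_def by simp
  then obtain U XB where U: "isometry (d1 * d2) m U" and XB: "XB \<in> carrier_mat m m" and eB: "?B = U * XB"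
    by (rule isometry_factorization_wide[OF vertex_mat_carrier(1) order.refl])
  obtain V XQ where V: "isometry (d2 * d3) r2 V" and XQ: "XQ \<in> carrier_mat r2 r2"
    and eQ: "mat_adjoint ?Q = V * XQ"
    by (rule isometry_factorization_wide[OF mat_adjoint_carrier[OF vertex_mat_carrier(2)] order.refl r2])
  have Uc: "U \<in> carrier_mat (d1 * d2) m" and Vc: "V \<in> carrier_mat (d2 * d3) r2"
    using U V unfolding isometry_def by auto
  have eQ': "?Q = mat_adjoint XQ * mat_adjoint V"
    using arg_cong[OF eQ, of mat_adjoint] mat_adjoint_mult[OF Vc XQ] by simp
  define P1 where "P1 = 1\<^sub>m (d1 * d2) - U * mat_adjoint U"
  define P2 where "P2 = V * mat_adjoint V"
  have P1: "orth_projector (d1 * d2) r1 P1"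
    using orth_projector_compl_isometry_proj[OF U] r1 unfolding P1_def m_def by simp
  have P2: "orth_projector (d2 * d3) r2 P2" unfolding P2_def by (rule orth_projector_isometry_proj[OF V])
  let ?\<beta> = "kron_id_left d1 (mat_adjoint V) * kron_id_right d3 U"
  have "kron_id_right d3 U \<in> carrier_mat (d1 * (d2 * d3)) (m * d3)"
    using kron_id_right_carrier[OF Uc] by (simp add: mult.assoc)
  then have "?\<beta> \<in> carrier_mat (d1 * r2) (m * d3)"
    by (rule mult_carrier_mat[OF kron_id_left_carrier[OF mat_adjoint_carrier[OF Vc]]])
  then have "vec_space.rank (d1 * r2) ?\<beta> + kernel_dim ?\<beta> = m * d3" by (rule rank_plus_kernel_dim)
  moreover have "gqsat3_H d1 d2 d3 P1 P2 = kron_id_right d3 P1 + kron_id_left d1 P2"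
    using P1 P2 d2 d3 by (intro gqsat3_H_eq_kron) (auto simp: orth_projector_def)
  then have "kernel_dim (gqsat3_H d1 d2 d3 P1 P2) \<le> kernel_dim ?\<beta>"
    unfolding P1_def P2_def by (simp add: kernel_dim_hamiltonian_le_network[OF U V N d3])
  moreover have "vec_space.rank (d1 * r2) (G3_beta m d1 d2 d3 r2 Tx Ty) \<le> vec_space.rank (d1 * r2) ?\<beta>"
    unfolding G3_beta_eq_kron eQ' eB
    by (rule rank_network_mono[OF Uc XB mat_adjoint_carrier[OF Vc] mat_adjoint_carrier[OF XQ] N d3])
  ultimately have "kernel_dim (gqsat3_H d1 d2 d3 P1 P2) + vec_space.rank (d1 * r2) (G3_beta m d1 d2 d3 r2 Tx Ty)
      \<le> m * d3" by linarith
  with P1 P2 show ?thesis unfolding m_def by blast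
qed

lemma hamiltonian_kernel_plus_network_rank_ge:
  fixes d1 d2 d3 r1 r2 :: nat
  assumes d2: "0 < d2" and d3: "0 < d3"
    and P1: "orth_projector (d1 * d2) r1 P1" and P2: "orth_projector (d2 * d3) r2 P2"
  shows "\<exists>Tx Ty. (d1 * d2 - r1) * d3
    \<le> kernel_dim (gqsat3_H d1 d2 d3 P1 P2) + vec_space.rank (d1 * r2) (G3_beta (d1 * d2 - r1) d1 d2 d3 r2 Tx Ty)"
proof -
  define m where "m = d1 * d2 - r1"
  have P1c: "P1 \<in> carrier_mat (d1 * d2) (d1 * d2)" and P2c: "P2 \<in> carrier_mat (d2 * d3) (d2 * d3)"
    and rk2: "vec_space.rank (d2 * d3) P2 = r2" using P1 P2 unfolding orth_projector_def by auto
  obtain B where B: "isometry (d1 * d2) m B" and P1B: "P1 * B = 0\<^sub>m (d1 * d2) m"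
    unfolding m_def by (rule isometry_onto_kernel[OF P1])
  obtain Z Q where Z: "Z \<in> carrier_mat (d2 * d3) r2" and Q: "Q \<in> carrier_mat r2 (d2 * d3)" and eP2: "P2 = Z * Q"
    using rank_factorization[OF P2c] unfolding rk2 by blast
  have Bc: "B \<in> carrier_mat (d1 * d2) m" using B unfolding isometry_def by auto
  define Tx where "Tx = (\<lambda>s t k. B $$ (t * d2 + k, s))"
  define Ty where "Ty = (\<lambda>k c t. Q $$ (t, k * d3 + c))"
  let ?\<beta> = "G3_beta m d1 d2 d3 r2 Tx Ty"
  have \<beta>: "?\<beta> = kron_id_left d1 Q * kron_id_right d3 B"
    unfolding G3_beta_eq_kron Tx_def Ty_def vertex_x_mat_of_mat[OF Bc] vertex_y_mat_of_mat[OF Q] ..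
  have "kron_id_right d3 B \<in> carrier_mat (d1 * (d2 * d3)) (m * d3)"
    using kron_id_right_carrier[OF Bc] by (simp add: mult.assoc)
  then have "?\<beta> \<in> carrier_mat (d1 * r2) (m * d3)" unfolding \<beta> by (rule mult_carrier_mat[OF kron_id_left_carrier[OF Q]])
  then have "vec_space.rank (d1 * r2) ?\<beta> + kernel_dim ?\<beta> = m * d3" by (rule rank_plus_kernel_dim)
  moreover have "kernel_dim ?\<beta> \<le> kernel_dim (gqsat3_H d1 d2 d3 P1 P2)"
    unfolding \<beta> gqsat3_H_eq_kron[OF P1c P2c d2 d3] unfolding eP2
    by (rule kernel_dim_network_le_hamiltonian[OF B P1c P1B Z Q _ d3]) (simp add: mult.assoc)
  ultimately have "m * d3 \<le> kernel_dim (gqsat3_H d1 d2 d3 P1 P2) + vec_space.rank (d1 * r2) ?\<beta>" by linarith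
  then show ?thesis unfolding m_def by blast
qed

lemma Inf_add_Sup_eq:
  fixes S R :: "nat set"
  assumes R: "R \<noteq> {}"
    and le: "\<And>r. r \<in> R \<Longrightarrow> \<exists>s\<in>S. s + r \<le> c" and ge: "\<And>s. s \<in> S \<Longrightarrow> \<exists>r\<in>R. c \<le> s + r"
  shows "Inf S + Sup R = c"
proof -
  have "R \<subseteq> {..c}" using le by force
  then have fin: "finite R" and bdd: "bdd_above R" by (auto intro: finite_subset bdd_above_Iic[THEN bdd_above_mono])
  have "Sup R \<in> R" using Max_in[OF fin R] cSup_eq_Max[OF fin R] by simp
  with le obtain s where s: "s \<in> S" "s + Sup R \<le> c" by blast
  then have "Inf S \<in> S" "Inf S \<le> s" by (auto intro: Inf_nat_def1 cInf_lower)
  with ge obtain r where "r \<in> R" "c \<le> Inf S + r" by blast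
  with s \<open>Inf S \<le> s\<close> cSup_upper[OF \<open>r \<in> R\<close> bdd] show ?thesis by linarith
qed

theorem claim6p1:
  fixes d1 d2 d3 r1 r2 :: nat
  assumes "0 < d1" "0 < d2" "0 < d3" "0 < r1" "0 < r2"
    and "r1 < d1 * d2" and "r2 \<le> d2 * d3"
  shows "int (GQSAT3 d1 d2 d3 r1 r2)
       = int d3 * (int (d1 * d2) - int r1) - int (QMF_G3 (d1 * d2 - r1) d1 d2 d3 r2)"
proof -
  have "GQSAT3 d1 d2 d3 r1 r2 + QMF_G3 (d1 * d2 - r1) d1 d2 d3 r2 = (d1 * d2 - r1) * d3"
    unfolding GQSAT3_def QMF_G3_def
    using hamiltonian_kernel_plus_network_rank_le[of d2 d3 r1 d1 r2]
      hamiltonian_kernel_plus_network_rank_ge[of d2 d3 d1 r1] assms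
    by (intro Inf_add_Sup_eq) fastforce+
  then show ?thesis using assms by (simp add: of_nat_diff algebra_simps flip: of_nat_add)
qed

end
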